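(* Let $\Omega\subset\mathbb{R}^n$ be a domain and suppose $u\ge 0$ is a uniform limit on $\Omega$ of positive stable solutions $u_j$ of $\Delta u_j=\frac1{u_j}$ on $\Omega$, with singular set $A=\{x\in\Omega: u(x)=0\}$. Then the Hausdorff dimension of $A$ satisfies $\dim_{\mathcal H}(A)\le n-4-2\sqrt2$.
   Context: A positive (smooth) solution $v$ of $\Delta v=\frac1v$ on $\Omega$ is called stable if $\int_\Omega \frac{\zeta^2}{v^2}\le\int_\Omega|D\zeta|^2$ for all test functions $\zeta\in C_c^1(\Omega)$. When the right-hand side $n-4-2\sqrt2$ is negative (i.e. $n\le 6$), the conclusion is read as $A=\emptyset$ (convention $\dim_{\mathcal H}(\emptyset)=-\infty$). *)

theory Defs
  imports "HOL-Analysis.Analysis"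
begin

section \<open>Differential operators on open subsets of $R^n$\<close>

definition partial_deriv :: "'n::finite \<Rightarrow> (real^'n \<Rightarrow> real) \<Rightarrow> real^'n \<Rightarrow> real" where
  "partial_deriv i f x = frechet_derivative f (at x) (axis i 1)"

definition gradient :: "(real^'n::finite \<Rightarrow> real) \<Rightarrow> real^'n \<Rightarrow> real^'n" where
  "gradient f x = (\<chi> i. partial_deriv i f x)"

definition laplacian :: "(real^'n::finite \<Rightarrow> real) \<Rightarrow> real^'n \<Rightarrow> real" where
  "laplacian f x = (\<Sum>i\<in>UNIV. partial_deriv i (partial_deriv i f) x)"

text \<open>The class \<open>C\<^sup>k(S)\<close>; only meaningful for open \<open>S\<close>, where differentiability within \<open>S\<close>
  and the two-sided derivatives in \<open>partial_deriv\<close> agree. Values outside \<open>S\<close> play no role.\<close>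

primrec Ck_on :: "nat \<Rightarrow> (real^'n::finite) set \<Rightarrow> (real^'n \<Rightarrow> real) \<Rightarrow> bool" where
  "Ck_on 0 S f \<longleftrightarrow> continuous_on S f"
| "Ck_on (Suc k) S f \<longleftrightarrow> f differentiable_on S \<and> (\<forall>i. Ck_on k S (partial_deriv i f))"

definition smooth_on :: "(real^'n::finite) set \<Rightarrow> (real^'n \<Rightarrow> real) \<Rightarrow> bool" where
  "smooth_on S f \<longleftrightarrow> (\<forall>k. Ck_on k S f)"

definition C1_compact_support :: "(real^'n::finite) set \<Rightarrow> (real^'n \<Rightarrow> real) \<Rightarrow> bool" where
  "C1_compact_support \<Omega> \<zeta> \<longleftrightarrow>
     Ck_on 1 \<Omega> \<zeta> \<and>
     compact (closure {x\<in>\<Omega>. \<zeta> x \<noteq> 0}) \<and> closure {x\<in>\<Omega>. \<zeta> x \<noteq> 0} \<subseteq> \<Omega>"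


section \<open>Positive stable solutions of $\Delta v = 1/v$\<close>

definition positive_solution :: "(real^'n::finite) set \<Rightarrow> (real^'n \<Rightarrow> real) \<Rightarrow> bool" where
  "positive_solution \<Omega> v \<longleftrightarrow>
     smooth_on \<Omega> v \<and> (\<forall>x\<in>\<Omega>. v x > 0) \<and> (\<forall>x\<in>\<Omega>. laplacian v x = 1 / v x)"

text \<open>For \<open>\<Omega>\<close> open and \<open>v\<close> positive and continuous on \<open>\<Omega>\<close>, both integrands are continuous
  with compact support in \<open>\<Omega>\<close>, so both integrals exist and are finite.\<close>

definition stable_on :: "(real^'n::finite) set \<Rightarrow> (real^'n \<Rightarrow> real) \<Rightarrow> bool" where
  "stable_on \<Omega> v \<longleftrightarrow>
     (\<forall>\<zeta>. C1_compact_support \<Omega> \<zeta> \<longrightarrow>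
        (LINT x:\<Omega>|lebesgue. (\<zeta> x)\<^sup>2 / (v x)\<^sup>2) \<le> (LINT x:\<Omega>|lebesgue. (norm (gradient \<zeta> x))\<^sup>2))"


section \<open>Hausdorff measure and Hausdorff dimension\<close>

text \<open>The number \<open>(diam U)\<^sup>s\<close>, with the usual conventions that \<open>(diam U)\<^sup>0 = 1\<close> for every
  nonempty \<open>U\<close> (whereas \<open>0 powr 0 = 0\<close>) and that the empty set contributes \<open>0\<close>.\<close>

definition diam_pow :: "real \<Rightarrow> 'a::metric_space set \<Rightarrow> ennreal" where
  "diam_pow s U =
     (if U = {} then 0 else if s = 0 then 1 else ennreal (diameter U powr s))"

text \<open>Boundedness is required explicitly because \<open>diameter\<close> is unspecified on unbounded sets.
  No normalising constant is used; it does not affect the dimension.\<close>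

definition hausdorff_premeasure :: "real \<Rightarrow> real \<Rightarrow> 'a::metric_space set \<Rightarrow> ennreal" where
  "hausdorff_premeasure s \<delta> A =
     (INF U\<in>{U :: nat \<Rightarrow> 'a set. A \<subseteq> (\<Union>i. U i) \<and> (\<forall>i. bounded (U i) \<and> diameter (U i) \<le> \<delta>)}.
        \<Sum>i. diam_pow s (U i))"

definition hausdorff_measure :: "real \<Rightarrow> 'a::metric_space set \<Rightarrow> ennreal" where
  "hausdorff_measure s A = (SUP \<delta>\<in>{0<..}. hausdorff_premeasure s \<delta> A)"

definition hausdorff_dim :: "'a::metric_space set \<Rightarrow> ereal" where
  "hausdorff_dim A =
     (if A = {} then -\<infinity> else Inf {ereal s | s. 0 \<le> s \<and> hausdorff_measure s A = 0})"

lemma hausdorff_dim_nonneg: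
  assumes "A \<noteq> {}"
  shows "0 \<le> hausdorff_dim A"
  using assms by (auto simp: hausdorff_dim_def intro!: Inf_greatest)

text \<open>Hence a negative upper bound on the dimension says exactly that the set is empty.\<close>

lemma hausdorff_dim_le_neg_iff:
  assumes "c < 0"
  shows "hausdorff_dim A \<le> ereal c \<longleftrightarrow> A = {}"
proof
  assume "hausdorff_dim A \<le> ereal c"
  moreover have "ereal c < 0" using assms by simp
  ultimately show "A = {}" using hausdorff_dim_nonneg[of A] by (meson leD order_trans not_le)
qed (simp add: hausdorff_dim_def)

end

theory Submission
  imports Defs
begin

text \<open>
  The singular set is small because negative powers of stable solutions are integrable, uniformly
  along the sequence, while each zero of the limit forces these integrals to be large at every scale.

  Upper bound. Testing the equation with \<open>\<eta>\<^sup>2 * v powr (- (2 * p + 1))\<close> and the stability inequality with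
  \<open>\<eta> * v powr (- p)\<close> produces two relations between the integrals of \<open>\<eta>\<^sup>2 * v powr (- (2 * p + 2))\<close> and of
  the same function times the squared gradient of \<open>v\<close>. They are incompatible up to terms with the gradient
  of \<open>\<eta>\<close> as long as \<open>p\<^sup>2 < 2 * p + 1\<close>. Hence for every \<open>q < 4 + 2 * sqrt 2\<close> with \<open>q \<ge> 2\<close> the
  integral of \<open>v powr (- q)\<close> over a fixed ball is bounded by a constant that does not depend on \<open>v\<close>
  (\<open>stable_solution_negative_power_bound\<close>).

  Lower bound. Stability with a plain cut-off bounds the integral of \<open>1 / v\<^sup>2\<close>, hence of \<open>1 / v\<close>, on
  balls of radius \<open>r\<close> by the natural power of \<open>r\<close>. As \<open>1 / v\<close> is the Laplacian of \<open>v\<close>, it controls how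
  averages of \<open>v\<close> over balls grow: they exceed \<open>v x\<close> by at most a constant times \<open>r\<close>
  (\<open>stable_solution_average_growth\<close>). If \<open>v x \<le> r\<close>, Jensen's inequality shows that the integral of
  \<open>v powr (- q)\<close> over \<open>cball x r\<close> is at least a constant times \<open>r powr (n - q)\<close>
  (\<open>stable_solution_concentration\<close>). This replaces the Lipschitz estimate that one would otherwise use
  near the zero set.

  Comparison. If \<open>N\<close> points of the zero set near a given point have disjoint balls of radius \<open>r\<close>, the
  two bounds for a late member of the sequence give \<open>N * r powr (n - q) \<le> C\<close>
  (\<open>zero_set_packing\<close>). For \<open>q < n\<close> such a packing bound makes the \<open>s\<close>-dimensional Hausdorff measure
  vanish for every \<open>s > n - q\<close>; for \<open>q > n\<close> it rules out even one zero. Letting \<open>q\<close> tend to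
  \<open>4 + 2 * sqrt 2\<close> yields the theorem.
\<close>

section \<open>Compactly supported functions and Green's identity\<close>

lemma gradient_eqI:
  assumes "GDERIV f x :> D"
  shows "gradient f x = D"
proof -
  have "frechet_derivative f (at x) = (\<lambda>h. inner h D)"
    using assms frechet_derivative_at unfolding gderiv_def by metis
  then show ?thesis
    by (simp add: gradient_def partial_deriv_def vec_eq_iff inner_axis')
qed

lemma GDERIV_gradient:
  assumes "f differentiable (at x)"
  shows "GDERIV f x :> gradient f x"
proof -
  define L where "L = frechet_derivative f (at x)"
  have d: "(f has_derivative L) (at x)"
    using assms by (simp add: L_def frechet_derivative_works)
  interpret bounded_linear L using d by (rule has_derivative_bounded_linear)
  have "L h = inner h (gradient f x)" for h
  proof -
    have "L h = L (\<Sum>i\<in>UNIV. h $ i *\<^sub>R axis i 1)"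
      using basis_expansion[of h] by (simp add: scalar_mult_eq_scaleR)
    also have "\<dots> = (\<Sum>i\<in>UNIV. h $ i * L (axis i 1))"
      by (simp add: sum scaleR)
    also have "\<dots> = inner h (gradient f x)"
      by (simp add: inner_vec_def gradient_def partial_deriv_def L_def)
    finally show ?thesis .
  qed
  then have "L = (\<lambda>h. inner h (gradient f x))" by blast
  with d show ?thesis by (simp add: gderiv_def)
qed

text \<open>The functions are required to vanish on the whole complement of a compact subset of \<open>\<Omega>\<close>,
  also outside \<open>\<Omega>\<close>, so that every integral over \<open>\<Omega>\<close> can be taken over the whole space.\<close>

definition Cc_on :: "(real^'n::finite) set \<Rightarrow> (real^'n \<Rightarrow> 'b::real_normed_vector) \<Rightarrow> bool" where
  "Cc_on \<Omega> g \<longleftrightarrow> continuous_on \<Omega> g \<and> (\<exists>K. compact K \<and> K \<subseteq> \<Omega> \<and> (\<forall>x. x \<notin> K \<longrightarrow> g x = 0))"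

lemma Cc_onI:
  "continuous_on \<Omega> g \<Longrightarrow> compact K \<Longrightarrow> K \<subseteq> \<Omega> \<Longrightarrow> (\<And>x. x \<notin> K \<Longrightarrow> g x = 0) \<Longrightarrow> Cc_on \<Omega> g"
  unfolding Cc_on_def by blast

lemma Cc_on_bilinear:
  assumes "Cc_on \<Omega> f" "continuous_on \<Omega> h" "bounded_bilinear B"
  shows "Cc_on \<Omega> (\<lambda>x. B (f x) (h x))" 
proof -
  obtain K where K: "compact K" "K \<subseteq> \<Omega>" "\<And>x. x \<notin> K \<Longrightarrow> f x = 0"
    using assms(1) unfolding Cc_on_def by blast
  have "continuous_on \<Omega> f" using assms(1) unfolding Cc_on_def by blast
  then have "continuous_on \<Omega> (\<lambda>x. B (f x) (h x))"
    using assms(2,3) bounded_bilinear.continuous_on by blast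
  then show ?thesis
    using K by (intro Cc_onI[of _ _ K]) (auto simp: bounded_bilinear.zero_left[OF assms(3)])
qed

lemmas Cc_on_mult = Cc_on_bilinear[OF _ _ bounded_bilinear_mult]
lemmas Cc_on_inner = Cc_on_bilinear[OF _ _ bounded_bilinear_inner]

lemma Cc_on_integrable:
  fixes g :: "real^'n::finite \<Rightarrow> real"
  assumes "Cc_on \<Omega> g"
  shows "integrable lborel g"
proof -
  obtain K where K: "compact K" "K \<subseteq> \<Omega>" "\<And>x. x \<notin> K \<Longrightarrow> g x = 0"
    using assms unfolding Cc_on_def by blast
  have "continuous_on K g" using assms K unfolding Cc_on_def by (meson continuous_on_subset)
  then have "integrable lborel (\<lambda>x. indicator K x *\<^sub>R g x)"
    using K by (intro borel_integrable_compact)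
  moreover have "(\<lambda>x. indicator K x *\<^sub>R g x) = g"
    using K by (auto simp: indicator_def fun_eq_iff)
  ultimately show ?thesis by simp
qed

text \<open>The function is continuous on each of the two open sets \<open>\<Omega>\<close> and \<open>- K\<close>, which cover
  the space.\<close>

lemma Cc_on_continuous_UNIV:
  assumes "Cc_on \<Omega> g" "open \<Omega>"
  shows "continuous_on UNIV g"
proof -
  obtain K where K: "compact K" "K \<subseteq> \<Omega>" "\<And>x. x \<notin> K \<Longrightarrow> g x = 0"
    using assms unfolding Cc_on_def by blast
  have "continuous_on (- K) g"
    using K by (subst continuous_on_cong[of _ _ _ "\<lambda>_. 0"]) auto
  moreover have "continuous_on \<Omega> g" using assms unfolding Cc_on_def by blast
  moreover have "open (- K)" using K by (simp add: compact_imp_closed open_Compl)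
  ultimately have "continuous_on (\<Omega> \<union> - K) g"
    using assms by (intro continuous_on_open_Un) auto
  moreover have "\<Omega> \<union> - K = UNIV" using K by auto
  ultimately show ?thesis by simp
qed

text \<open>The gradient is carried along as an argument: gradients of products and powers are then obtained
  from the calculus of \<open>GDERIV\<close>, and the integral identities below mention it explicitly.\<close>

definition test_function ::
  "(real^'n::finite) set \<Rightarrow> (real^'n \<Rightarrow> real) \<Rightarrow> (real^'n \<Rightarrow> real^'n) \<Rightarrow> bool" where
  "test_function \<Omega> f Df \<longleftrightarrow>
     (\<forall>x. GDERIV f x :> Df x) \<and> continuous_on UNIV Df \<and>
     (\<exists>K. compact K \<and> K \<subseteq> \<Omega> \<and> (\<forall>x. x \<notin> K \<longrightarrow> f x = 0))"

lemma test_function_support: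
  assumes "test_function \<Omega> f Df"
  obtains K where "compact K" "K \<subseteq> \<Omega>" "\<And>x. x \<notin> K \<Longrightarrow> f x = 0" "\<And>x. x \<notin> K \<Longrightarrow> Df x = 0"
proof -
  obtain K where K: "compact K" "K \<subseteq> \<Omega>" "\<And>x. x \<notin> K \<Longrightarrow> f x = 0"
    using assms unfolding test_function_def by blast
  have "Df x = 0" if x: "x \<notin> K" for x
  proof -
    have o: "open (- K)" using K by (simp add: compact_imp_closed open_Compl)
    have "(f has_derivative (\<lambda>h. 0)) (at x)"
      by (rule has_derivative_transform_within_open[of "\<lambda>_. 0" _ _ _ "- K"])
        (use o x K in auto)
    then have "GDERIV f x :> 0" by (simp add: gderiv_def)
    moreover have "GDERIV f x :> Df x" using assms unfolding test_function_def by blast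
    ultimately show ?thesis using gradient_eqI by metis
  qed
  with K that show ?thesis by blast
qed

lemma test_function_continuous:
  assumes "test_function \<Omega> f Df"
  shows "continuous_on S f"
  using assms unfolding test_function_def gderiv_def
  by (meson continuous_at_imp_continuous_on has_derivative_continuous)

lemma test_function_Cc:
  assumes "test_function \<Omega> f Df"
  shows "Cc_on \<Omega> f" and "Cc_on \<Omega> Df"
proof -
  obtain K where K: "compact K" "K \<subseteq> \<Omega>" "\<And>x. x \<notin> K \<Longrightarrow> f x = 0" "\<And>x. x \<notin> K \<Longrightarrow> Df x = 0"
    using test_function_support[OF assms] by blast
  show "Cc_on \<Omega> f" using K test_function_continuous[OF assms] by (intro Cc_onI[of _ _ K])
  have "continuous_on \<Omega> Df"
    using assms unfolding test_function_def by (meson continuous_on_subset subset_UNIV)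
  then show "Cc_on \<Omega> Df" using K by (intro Cc_onI[of _ _ K])
qed

text \<open>The second factor is a function such as a negative power of a solution: it is regular only on
  \<open>\<Omega>\<close> and has arbitrary values elsewhere. The support of \<open>f\<close> hides those values.\<close>

lemma test_function_mult:
  assumes f: "test_function \<Omega> f Df" and "open \<Omega>"
    and g: "\<And>x. x \<in> \<Omega> \<Longrightarrow> GDERIV g x :> Dg x" and cg: "continuous_on \<Omega> Dg"
  shows "test_function \<Omega> (\<lambda>x. f x * g x) (\<lambda>x. f x *\<^sub>R Dg x + g x *\<^sub>R Df x)"
proof -
  obtain K where K: "compact K" "K \<subseteq> \<Omega>" "\<And>x. x \<notin> K \<Longrightarrow> f x = 0" "\<And>x. x \<notin> K \<Longrightarrow> Df x = 0"
    using test_function_support[OF f] by blast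
  have o: "open (- K)" using K by (simp add: compact_imp_closed open_Compl)
  have contg: "continuous_on \<Omega> g"
    using g unfolding gderiv_def
    by (meson continuous_at_imp_continuous_on has_derivative_continuous)
  have "GDERIV (\<lambda>x. f x * g x) x :> f x *\<^sub>R Dg x + g x *\<^sub>R Df x" for x
  proof (cases "x \<in> \<Omega>")
    case True
    then show ?thesis using f g unfolding test_function_def by (intro GDERIV_mult) auto
  next
    case False
    then have x: "x \<notin> K" using K by blast
    have "((\<lambda>x. f x * g x) has_derivative (\<lambda>h. 0)) (at x)"
      by (rule has_derivative_transform_within_open[of "\<lambda>_. 0" _ _ _ "- K"])
        (use o x K in auto)
    then show ?thesis using K x by (simp add: gderiv_def)
  qed
  moreover have "continuous_on UNIV (\<lambda>x. f x *\<^sub>R Dg x + g x *\<^sub>R Df x)"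
  proof (rule Cc_on_continuous_UNIV)
    have "continuous_on \<Omega> f" "continuous_on \<Omega> Df"
      using test_function_Cc[OF f] unfolding Cc_on_def by blast+
    then show "Cc_on \<Omega> (\<lambda>x. f x *\<^sub>R Dg x + g x *\<^sub>R Df x)"
      using K cg contg by (intro Cc_onI[of _ _ K]) (auto intro!: continuous_intros)
  qed fact
  moreover have "\<exists>K. compact K \<and> K \<subseteq> \<Omega> \<and> (\<forall>x. x \<notin> K \<longrightarrow> f x * g x = 0)"
    using K by (intro exI[of _ K]) auto
  ultimately show ?thesis unfolding test_function_def by blast
qed

lemma integral_lborel_translate:
  fixes g :: "real^'n::finite \<Rightarrow> real"
  assumes "continuous_on UNIV g"
  shows "integral\<^sup>L lborel (\<lambda>x. g (c + x)) = integral\<^sup>L lborel g"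
proof -
  have "integral\<^sup>L (distr lborel borel ((+) c)) g = integral\<^sup>L lborel (\<lambda>x. g (c + x))"
    using borel_measurable_continuous_onI[OF assms] by (subst integral_distr) auto
  then show ?thesis by (simp add: lborel_distr_plus)
qed

lemma integral_cbox_eq_lborel:
  fixes g :: "real^'n::finite \<Rightarrow> real"
  assumes "continuous_on UNIV g" "\<And>x. x \<notin> cbox a b \<Longrightarrow> g x = 0"
  shows "integral (cbox a b) g = integral\<^sup>L lborel g"
proof -
  have "Cc_on UNIV g" using assms by (intro Cc_onI[of _ _ "cbox a b"]) auto
  then have "integrable lborel g" by (rule Cc_on_integrable)
  then have "integral UNIV g = integral\<^sup>L lborel g" by (rule integral_lborel)
  moreover have "integral UNIV g = integral (cbox a b) g"
  proof -
    have "g = (\<lambda>x. if x \<in> cbox a b then g x else 0)" using assms(2) by (auto simp: fun_eq_iff)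
    then show ?thesis
      using Henstock_Kurzweil_Integration.integral_restrict_UNIV[of "cbox a b" g] by simp
  qed
  ultimately show ?thesis by simp
qed

text \<open>The integral of \<open>x \<mapsto> g (t a + x)\<close> does not depend on \<open>t\<close>, by translation invariance
  of Lebesgue measure. Differentiation under the integral sign at \<open>t = 0\<close> gives the claim. This
  special case of the divergence theorem is the source of all integrations by parts below.\<close>

lemma integral_directional_derivative_zero:
  assumes "test_function UNIV g Dg"
  shows "integral\<^sup>L lborel (\<lambda>x. inner (Dg x) a) = 0"
proof -
  obtain K where K: "compact K" "K \<subseteq> UNIV" "\<And>x. x \<notin> K \<Longrightarrow> g x = 0" "\<And>x. x \<notin> K \<Longrightarrow> Dg x = 0"
    by (rule test_function_support[OF assms]) blast
  have cg: "continuous_on UNIV g" using test_function_continuous[OF assms] .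
  have cD: "continuous_on UNIV Dg" using assms unfolding test_function_def by blast
  have dg: "GDERIV g x :> Dg x" for x using assms unfolding test_function_def by blast
  \<comment> \<open>All translates of the support by \<open>- t a\<close> with \<open>\<bar>t\<bar> \<le> 1\<close> lie in one box, so
    that the domain of integration can be kept fixed.\<close>
  define L where "L = (\<lambda>(k, t). k - t *\<^sub>R a) ` (K \<times> {-1..1::real})"
  have "compact L"
    unfolding L_def using K
    by (intro compact_continuous_image compact_Times) (auto intro!: continuous_intros simp: case_prod_unfold)
  then have "bounded L" by (rule compact_imp_bounded)
  then obtain c where c: "L \<subseteq> cbox (-c) c"
    using bounded_subset_cbox_symmetric by blast
  have out: "t *\<^sub>R a + x \<notin> K" if "x \<notin> cbox (-c) c" "t \<in> {-1<..<1}" for x t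
  proof
    assume "t *\<^sub>R a + x \<in> K"
    then have "(\<lambda>(k, t). k - t *\<^sub>R a) (t *\<^sub>R a + x, t) \<in> L"
      unfolding L_def using that by (intro imageI) auto
    with c that show False by auto
  qed
  define H where "H t = integral (cbox (-c) c) (\<lambda>x. g (t *\<^sub>R a + x))" for t :: real
  have "(H has_field_derivative integral (cbox (-c) c) (\<lambda>x. inner (Dg (0 *\<^sub>R a + x)) a)) (at 0 within {-1<..<1})"
    unfolding H_def
  proof (rule leibniz_rule_field_derivative[where fx = "\<lambda>t x. inner (Dg (t *\<^sub>R a + x)) a"])
    show "((\<lambda>t. g (t *\<^sub>R a + x)) has_field_derivative inner (Dg (t *\<^sub>R a + x)) a) (at t within {-1<..<1})"
      for t x
    proof -
      have "((\<lambda>t. t *\<^sub>R a + x) has_derivative (\<lambda>h. h *\<^sub>R a)) (at t within {-1<..<1})"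
        by (auto intro!: derivative_eq_intros)
      then have "((\<lambda>t. g (t *\<^sub>R a + x)) has_derivative (\<lambda>h. inner (h *\<^sub>R a) (Dg (t *\<^sub>R a + x)))) (at t within {-1<..<1})"
        using dg[of "t *\<^sub>R a + x"] unfolding gderiv_def
        by (rule has_derivative_compose)
      then show ?thesis
        by (simp add: has_field_derivative_def inner_commute mult.commute[of _ "inner _ _"])
    qed
    show "(\<lambda>x. g (t *\<^sub>R a + x)) integrable_on cbox (-c) c" for t
      by (intro integrable_continuous continuous_on_compose2[OF cg] continuous_intros) auto
    show "continuous_on ({-1<..<1} \<times> cbox (-c) c) (\<lambda>(t, x). inner (Dg (t *\<^sub>R a + x)) a)"
      unfolding case_prod_unfold
      by (intro continuous_intros continuous_on_compose2[OF cD]) auto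
  qed auto
  then have H': "(H has_field_derivative integral (cbox (-c) c) (\<lambda>x. inner (Dg x) a)) (at 0)"
    using at_within_open[of "0::real" "{-1<..<1}"] by (simp only: scaleR_zero_left add_0) simp
  have "H t = integral\<^sup>L lborel g" if "t \<in> {-1<..<1}" for t
  proof -
    have "H t = integral\<^sup>L lborel (\<lambda>x. g (t *\<^sub>R a + x))"
      unfolding H_def using out[OF _ that] K
      by (intro integral_cbox_eq_lborel continuous_on_compose2[OF cg] continuous_intros) auto
    then show ?thesis using integral_lborel_translate[OF cg] by simp
  qed
  then have "(H has_field_derivative 0) (at 0)"
    using has_field_derivative_transform_within_open[of "\<lambda>_. integral\<^sup>L lborel g" 0 0 "{-1<..<1}" H]
    by simp
  with H' have "integral (cbox (-c) c) (\<lambda>x. inner (Dg x) a) = 0"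
    using DERIV_unique by blast
  moreover have "integral (cbox (-c) c) (\<lambda>x. inner (Dg x) a) = integral\<^sup>L lborel (\<lambda>x. inner (Dg x) a)"
  proof (rule integral_cbox_eq_lborel)
    show "continuous_on UNIV (\<lambda>x. inner (Dg x) a)" by (intro continuous_intros cD)
    show "inner (Dg x) a = 0" if "x \<notin> cbox (-c) c" for x
      using out[OF that, of 0] K by simp
  qed
  ultimately show ?thesis by simp
qed

lemma Ck_on_2D:
  assumes "Ck_on 2 \<Omega> v" "open \<Omega>"
  shows "\<And>x. x \<in> \<Omega> \<Longrightarrow> GDERIV v x :> gradient v x"
    and "continuous_on \<Omega> v" and "continuous_on \<Omega> (gradient v)"
    and "\<And>i x. x \<in> \<Omega> \<Longrightarrow> GDERIV (partial_deriv i v) x :> gradient (partial_deriv i v) x"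
    and "\<And>i. continuous_on \<Omega> (gradient (partial_deriv i v))"
    and "continuous_on \<Omega> (laplacian v)"
proof -
  have d: "v differentiable_on \<Omega>" "\<And>i. partial_deriv i v differentiable_on \<Omega>"
    "\<And>i j. continuous_on \<Omega> (partial_deriv j (partial_deriv i v))"
    using assms(1) by (simp_all add: numeral_2_eq_2)
  show "GDERIV v x :> gradient v x" if "x \<in> \<Omega>" for x
    using d(1) that assms(2) by (intro GDERIV_gradient) (simp add: differentiable_on_eq_differentiable_at)
  show "GDERIV (partial_deriv i v) x :> gradient (partial_deriv i v) x" if "x \<in> \<Omega>" for i x
    using d(2) that assms(2) by (intro GDERIV_gradient) (simp add: differentiable_on_eq_differentiable_at)
  show "continuous_on \<Omega> v" using d(1) by (rule differentiable_imp_continuous_on)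
  have "continuous_on \<Omega> (partial_deriv i v)" for i
    using d(2) by (rule differentiable_imp_continuous_on)
  then show "continuous_on \<Omega> (gradient v)"
    unfolding gradient_def by (intro continuous_on_vec_lambda)
  show "continuous_on \<Omega> (gradient (partial_deriv i v))" for i
    unfolding gradient_def using d(3) by (intro continuous_on_vec_lambda)
  show "continuous_on \<Omega> (laplacian v)"
    unfolding laplacian_def using d(3) by (intro continuous_intros)
qed

text \<open>Sum over \<open>i\<close> of the previous identity for the compactly supported functions
  \<open>f * partial_deriv i v\<close> in direction \<open>i\<close>.\<close>

lemma green_identity:
  assumes f: "test_function \<Omega> f Df" and "open \<Omega>" and v: "Ck_on 2 \<Omega> v"
  shows "integral\<^sup>L lborel (\<lambda>x. f x * laplacian v x) = - integral\<^sup>L lborel (\<lambda>x. inner (Df x) (gradient v x))"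
proof -
  note v2 = Ck_on_2D[OF v \<open>open \<Omega>\<close>]
  have i1: "integrable lborel (\<lambda>x. f x * laplacian v x)"
    by (rule Cc_on_integrable[OF Cc_on_mult[OF test_function_Cc(1)[OF f] v2(6)]])
  have i2: "integrable lborel (\<lambda>x. inner (Df x) (gradient v x))"
    by (rule Cc_on_integrable[OF Cc_on_inner[OF test_function_Cc(2)[OF f] v2(3)]])
  let ?G = "\<lambda>i x. f x *\<^sub>R gradient (partial_deriv i v) x + partial_deriv i v x *\<^sub>R Df x"
  have tf: "test_function \<Omega> (\<lambda>x. f x * partial_deriv i v x) (?G i)" for i
    by (intro test_function_mult f \<open>open \<Omega>\<close> v2)
  have z: "integral\<^sup>L lborel (\<lambda>x. inner (?G i x) (axis i 1)) = 0" for i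
  proof (rule integral_directional_derivative_zero)
    show "test_function UNIV (\<lambda>x. f x * partial_deriv i v x) (?G i)"
      using tf[of i] unfolding test_function_def by blast
  qed
  have "f x * laplacian v x + inner (Df x) (gradient v x) = (\<Sum>i\<in>UNIV. inner (?G i x) (axis i 1))" for x
    by (simp add: laplacian_def inner_vec_def[of "Df x"] inner_axis gradient_def sum_distrib_left
        sum.distrib[symmetric] algebra_simps)
  then have "integral\<^sup>L lborel (\<lambda>x. f x * laplacian v x + inner (Df x) (gradient v x))
      = integral\<^sup>L lborel (\<lambda>x. \<Sum>i\<in>UNIV. inner (?G i x) (axis i 1))"
    by simp
  also have "\<dots> = (\<Sum>i\<in>UNIV. integral\<^sup>L lborel (\<lambda>x. inner (?G i x) (axis i 1)))"
    by (rule Bochner_Integration.integral_sum)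
      (rule Cc_on_integrable[OF Cc_on_inner[OF test_function_Cc(2)[OF tf] continuous_on_const]])
  also have "\<dots> = 0" by (simp only: z sum.neutral_const)
  finally show ?thesis using i1 i2 by simp
qed

text \<open>The stability inequality with both integrals taken over the whole space and with respect to
  \<open>lborel\<close>, in which form it can be combined with Green's identity.\<close>

lemma stable_test_function:
  assumes "stable_on \<Omega> v" "open \<Omega>" and f: "test_function \<Omega> f Df" and cv: "continuous_on \<Omega> v"
    and pos: "\<And>x. x \<in> \<Omega> \<Longrightarrow> v x > 0"
  shows "integral\<^sup>L lborel (\<lambda>x. (f x)\<^sup>2 / (v x)\<^sup>2) \<le> integral\<^sup>L lborel (\<lambda>x. (norm (Df x))\<^sup>2)"
proof -
  obtain K where K: "compact K" "K \<subseteq> \<Omega>" "\<And>x. x \<notin> K \<Longrightarrow> f x = 0" "\<And>x. x \<notin> K \<Longrightarrow> Df x = 0"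
    using test_function_support[OF f] by blast
  have G: "gradient f = Df"
    using f gradient_eqI unfolding test_function_def by blast
  have cD: "continuous_on \<Omega> Df" using test_function_Cc(2)[OF f] by (simp add: Cc_on_def)
  have cf: "continuous_on \<Omega> f" using test_function_Cc(1)[OF f] by (simp add: Cc_on_def)
  have "closure {x \<in> \<Omega>. f x \<noteq> 0} \<subseteq> K"
    using K by (intro closure_minimal compact_imp_closed) auto
  moreover have "partial_deriv i f = (\<lambda>x. Df x $ i)" for i
    using G by (auto simp: gradient_def vec_eq_iff fun_eq_iff)
  moreover have "f differentiable_on \<Omega>"
    using f unfolding test_function_def gderiv_def
    by (meson differentiable_at_imp_differentiable_on differentiable_def)
  ultimately have "C1_compact_support \<Omega> f"
    using K cD unfolding C1_compact_support_def
    by (auto intro!: continuous_intros compact_closure[THEN iffD2] bounded_subset[OF compact_imp_bounded[OF K(1)]]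
      intro: order_trans[OF closure_subset])
  then have le: "(LINT x:\<Omega>|lebesgue. (f x)\<^sup>2 / (v x)\<^sup>2) \<le> (LINT x:\<Omega>|lebesgue. (norm (gradient f x))\<^sup>2)"
    using assms(1) unfolding stable_on_def by blast
  have conv: "(LINT x:\<Omega>|lebesgue. h x) = integral\<^sup>L lborel h"
    if h: "continuous_on \<Omega> h" "\<And>x. x \<notin> K \<Longrightarrow> h x = 0" for h :: "real^'a \<Rightarrow> real"
  proof -
    have "integrable lborel h"
      using h K by (intro Cc_on_integrable[of \<Omega>] Cc_onI[of _ _ K])
    moreover have "(\<lambda>x. indicator \<Omega> x *\<^sub>R h x) = h"
      using h K by (auto simp: indicator_def fun_eq_iff)
    ultimately show ?thesis
      unfolding set_lebesgue_integral_def by (simp add: integral_completion)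
  qed
  have "continuous_on \<Omega> (\<lambda>x. (f x)\<^sup>2 / (v x)\<^sup>2)"
    using pos cf cv by (intro continuous_intros) fastforce+
  moreover have "continuous_on \<Omega> (\<lambda>x. (norm (Df x))\<^sup>2)"
    using cD by (intro continuous_intros)
  ultimately show ?thesis using le K by (simp add: conv G)
qed

section \<open>Polynomial cut-off functions\<close>

text \<open>Powers of this function, from the second on, are \<open>C\<^sup>1\<close> cut-offs for \<open>cball x r\<close>. They are used
  because the gradient of a power of \<open>bump x r\<close> is a constant times the next lower power times
  \<open>y - x\<close>: the cut-off still dominates its gradient where it is small, and the vector field
  that appears when averages over balls are differentiated in \<open>r\<close> is itself a gradient.\<close>

definition bump :: "'a::real_inner \<Rightarrow> real \<Rightarrow> 'a \<Rightarrow> real" where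
  "bump x r y = max 0 (1 - (norm (y - x))\<^sup>2 / r\<^sup>2)"

lemma DERIV_max_0_power:
  fixes t :: real
  assumes "k \<ge> 2"
  shows "((\<lambda>t. max 0 t ^ k) has_field_derivative real k * max 0 t ^ (k - 1)) (at t)"
proof -
  consider "t > 0" | "t < 0" | "t = 0" by linarith
  then show ?thesis
  proof cases
    case 1
    have "((\<lambda>t. t ^ k) has_field_derivative real k * max 0 t ^ (k - 1)) (at t)"
      using 1 by (auto intro!: derivative_eq_intros)
    then show ?thesis
      using has_field_derivative_transform_within_open[of "\<lambda>t. t ^ k" _ t "{0<..}"] 1 by auto
  next
    case 2
    have "((\<lambda>t. 0) has_field_derivative real k * max 0 t ^ (k - 1)) (at t)"
      using 2 assms by (auto simp: power_0_left)
    then show ?thesis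
      using has_field_derivative_transform_within_open[of "\<lambda>t. 0" _ t "{..<0}"] 2 assms
      by (auto simp: power_0_left)
  next
    case 3
    \<comment> \<open>At the corner, Caratheodory's criterion applies with the continuous slope
      \<open>max 0 z ^ (k - 1)\<close>.\<close>
    have "(\<lambda>t. max 0 t ^ k) z - (\<lambda>t. max 0 t ^ k) t = max 0 z ^ (k - 1) * (z - t)" for z :: real
      using 3 assms by (cases "z \<ge> 0") (auto simp: power_0_left simp flip: power_Suc2)
    moreover have "isCont (\<lambda>z. max 0 z ^ (k - 1)) t" by (intro continuous_intros)
    ultimately show ?thesis
      using 3 assms unfolding CARAT_DERIV
      by (intro exI[of _ "\<lambda>z. max 0 z ^ (k - 1)"]) (auto simp: power_0_left)
  qed
qed

lemma bump_nonneg: "0 \<le> bump x r y" by (simp add: bump_def)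

lemma bump_le_1: "bump x r y \<le> 1" by (simp add: bump_def)

lemma bump_outside: "r > 0 \<Longrightarrow> y \<notin> cball x r \<Longrightarrow> bump x r y = 0"
  by (auto simp: bump_def dist_norm norm_minus_commute max_def divide_simps)

lemma bump_ge: "r > 0 \<Longrightarrow> y \<in> cball x (r / 2) \<Longrightarrow> 3 / 4 \<le> bump x r y"
proof -
  assume r: "r > 0" and y: "y \<in> cball x (r / 2)"
  have "(norm (y - x))\<^sup>2 \<le> (r / 2)\<^sup>2"
    using y by (intro power_mono) (auto simp: dist_norm norm_minus_commute)
  then have "(norm (y - x))\<^sup>2 / r\<^sup>2 \<le> 1 / 4"
    using r by (simp add: divide_simps power2_eq_square)
  then have "3 / 4 \<le> 1 - (norm (y - x))\<^sup>2 / r\<^sup>2" by linarith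
  then show ?thesis unfolding bump_def by (rule order_trans) simp
qed

lemma continuous_on_bump: "continuous_on S (bump x r)"
  unfolding bump_def divide_inverse by (intro continuous_intros)

lemma test_function_bump:
  assumes "cball x r \<subseteq> \<Omega>" "r > 0" "k \<ge> 2"
  shows "test_function \<Omega> (\<lambda>y. bump x r y ^ k)
    (\<lambda>y. (- (2 * real k / r\<^sup>2) * bump x r y ^ (k - 1)) *\<^sub>R (y - x))"
  unfolding test_function_def
proof (intro conjI allI)
  fix y
  have "GDERIV (\<lambda>y. 1 - (norm (y - x))\<^sup>2 / r\<^sup>2) y :> (- (2 / r\<^sup>2)) *\<^sub>R (y - x)"
    unfolding gderiv_def power2_norm_eq_inner divide_inverse
    by (auto intro!: derivative_eq_intros simp: inner_commute fun_eq_iff algebra_simps inner_diff_left inner_diff_right)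
  from GDERIV_DERIV_compose[OF this DERIV_max_0_power[OF assms(3)]]
  show "GDERIV (\<lambda>y. bump x r y ^ k) y :> (- (2 * real k / r\<^sup>2) * bump x r y ^ (k - 1)) *\<^sub>R (y - x)"
    by (simp add: bump_def algebra_simps)
next
  show "continuous_on UNIV (\<lambda>y. (- (2 * real k / r\<^sup>2) * bump x r y ^ (k - 1)) *\<^sub>R (y - x))"
    by (intro continuous_intros continuous_on_bump)
  show "\<exists>K. compact K \<and> K \<subseteq> \<Omega> \<and> (\<forall>y. y \<notin> K \<longrightarrow> bump x r y ^ k = 0)"
    using assms bump_outside[OF assms(2), of _ x] by (intro exI[of _ "cball x r"]) (auto simp: power_0_left)
qed

lemma norm_gradient_bump_le:
  assumes "r > 0" "k \<ge> 2"
  shows "norm ((- (2 * real k / r\<^sup>2) * bump x r y ^ (k - 1)) *\<^sub>R (y - x)) \<le> (2 * real k / r) * bump x r y ^ (k - 1)"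
proof (cases "y \<in> cball x r")
  case True
  then have "norm (y - x) \<le> r" by (simp add: dist_norm norm_minus_commute)
  then have "(2 * real k / r\<^sup>2) * bump x r y ^ (k - 1) * norm (y - x)
      \<le> (2 * real k / r\<^sup>2) * bump x r y ^ (k - 1) * r"
    using assms by (intro mult_left_mono) (auto simp: bump_nonneg)
  then show ?thesis using assms by (simp add: bump_nonneg power2_eq_square)
next
  case False
  then have "bump x r y = 0" using bump_outside assms by blast
  then show ?thesis using assms by (simp add: power_0_left)
qed

section \<open>Negative powers of stable solutions\<close>

text \<open>The hypotheses on a single solution that enter the estimates; smoothness is represented by the
  two derivatives that occur in the equation.\<close>

definition stable_solution :: "(real^'n::finite) set \<Rightarrow> (real^'n \<Rightarrow> real) \<Rightarrow> bool" where
  "stable_solution \<Omega> v \<longleftrightarrow> open \<Omega> \<and> Ck_on 2 \<Omega> v \<and> (\<forall>x\<in>\<Omega>. v x > 0) \<and>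
     (\<forall>x\<in>\<Omega>. laplacian v x = 1 / v x) \<and> stable_on \<Omega> v"

lemma GDERIV_powr:
  assumes "GDERIV v x :> D" "v x > 0"
  shows "GDERIV (\<lambda>x. v x powr a) x :> (a * v x powr (a - 1)) *\<^sub>R D"
  using GDERIV_DERIV_compose[OF assms(1) has_real_derivative_powr[OF assms(2)]] .

lemma test_function_outside:
  assumes "test_function \<Omega> f Df" "x \<notin> \<Omega>"
  shows "f x = 0" "Df x = 0"
proof -
  obtain K where "compact K" "K \<subseteq> \<Omega>" "\<And>x. x \<notin> K \<Longrightarrow> f x = 0" "\<And>x. x \<notin> K \<Longrightarrow> Df x = 0"
    using test_function_support[OF assms(1)] by blast
  then show "f x = 0" "Df x = 0" using assms(2) by blast+
qed

text \<open>Three relations between the integrals \<open>X\<close>, \<open>Y\<close>, \<open>Z\<close>, \<open>W\<close>. The first is the equation tested with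
  \<open>\<eta>\<^sup>2 * v powr (- (2 * p + 1))\<close>, the second is stability with the test function
  \<open>\<eta> * v powr (- p)\<close>, and the third is the Cauchy-Schwarz inequality for the mixed term
  \<open>W\<close>.\<close>

lemma stable_solution_absorption:
  assumes v: "stable_solution \<Omega> v" and \<eta>: "test_function \<Omega> \<eta> D\<eta>" and p: "p \<ge> 0"
  defines "X \<equiv> integral\<^sup>L lborel (\<lambda>x. (\<eta> x)\<^sup>2 * v x powr (- (2 * p + 2)))"
    and "Y \<equiv> integral\<^sup>L lborel (\<lambda>x. (norm (D\<eta> x))\<^sup>2 * v x powr (- (2 * p)))"
    and "Z \<equiv> integral\<^sup>L lborel (\<lambda>x. (\<eta> x)\<^sup>2 * (v x powr (- (2 * p + 2)) * (norm (gradient v x))\<^sup>2))"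
    and "W \<equiv> integral\<^sup>L lborel (\<lambda>x. \<eta> x * (v x powr (- (2 * p + 1)) * inner (D\<eta> x) (gradient v x)))"
  shows "X = (2 * p + 1) * Z - 2 * W"
    and "X \<le> p\<^sup>2 * Z - 2 * p * W + Y"
    and "\<epsilon> > 0 \<Longrightarrow> 2 * \<bar>W\<bar> \<le> \<epsilon> * Z + Y / \<epsilon>"
    and "Z \<ge> 0" and "Y \<ge> 0" and "X \<ge> 0"
proof -
  have o: "open \<Omega>" and C2: "Ck_on 2 \<Omega> v" and pos: "\<And>x. x \<in> \<Omega> \<Longrightarrow> v x > 0"
    and eq: "\<And>x. x \<in> \<Omega> \<Longrightarrow> laplacian v x = 1 / v x" and st: "stable_on \<Omega> v"
    using v unfolding stable_solution_def by auto
  note v2 = Ck_on_2D[OF C2 o]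
  note out = test_function_outside[OF \<eta>]
  have ce: "continuous_on \<Omega> \<eta>" and cD: "continuous_on \<Omega> D\<eta>"
    using test_function_Cc[OF \<eta>] by (auto simp: Cc_on_def)
  have ge: "\<And>x. GDERIV \<eta> x :> D\<eta> x" using \<eta> unfolding test_function_def by blast
  have cp: "continuous_on \<Omega> (\<lambda>x. v x powr a)" for a
    using v2(2) pos by (intro continuous_intros) force+
  have pw: "v x powr (- (2 * p + 2)) = (v x powr (- p))\<^sup>2 / (v x)\<^sup>2"
      "v x powr (- (2 * p + 1)) = (v x powr (- p))\<^sup>2 / v x"
      "v x powr (- (2 * p)) = (v x powr (- p))\<^sup>2"
      "v x powr (- p - 1) = v x powr (- p) / v x" 
      "v x powr (- (2 * p + 1) - 1) = (v x powr (- p))\<^sup>2 / (v x)\<^sup>2" if "x \<in> \<Omega>" for x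
  proof -
    have [simp]: "v x > 0" "v x \<noteq> 0" "v x \<ge> 0" using pos[OF that] by auto
    have a: "(v x powr (- p))\<^sup>2 = v x powr (- (2 * p))"
      by (simp add: power2_eq_square flip: powr_add)
    have b: "(v x)\<^sup>2 = v x powr 2" using less_imp_le[OF pos[OF that]] by simp
    show "v x powr (- (2 * p + 2)) = (v x powr (- p))\<^sup>2 / (v x)\<^sup>2"
      unfolding a b using powr_diff[of "v x" "- (2 * p)" 2] by (simp only: minus_add_distrib diff_conv_add_uminus)
    show "v x powr (- (2 * p + 1)) = (v x powr (- p))\<^sup>2 / v x"
      unfolding a using powr_diff[of "v x" "- (2 * p)" 1] less_imp_le[OF pos[OF that]] by simp
    show "v x powr (- (2 * p)) = (v x powr (- p))\<^sup>2" using a by simp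
    show "v x powr (- p - 1) = v x powr (- p) / v x" by (simp add: powr_diff)
    have "- (2 * p + 1) - 1 = - (2 * p) - 2" by simp
    then show "v x powr (- (2 * p + 1) - 1) = (v x powr (- p))\<^sup>2 / (v x)\<^sup>2"
      unfolding a b by (simp only: powr_diff)
  qed
  have CcE: "Cc_on \<Omega> (\<lambda>x. (\<eta> x)\<^sup>2)"
    unfolding power2_eq_square by (rule Cc_on_mult[OF test_function_Cc(1)[OF \<eta>] ce])
  have CcD: "Cc_on \<Omega> (\<lambda>x. (norm (D\<eta> x))\<^sup>2)"
    unfolding power2_norm_eq_inner by (rule Cc_on_inner[OF test_function_Cc(2)[OF \<eta>] cD])
  have iX: "integrable lborel (\<lambda>x. (\<eta> x)\<^sup>2 * v x powr (- (2 * p + 2)))"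
    by (rule Cc_on_integrable[OF Cc_on_mult[OF CcE cp]])
  have iY: "integrable lborel (\<lambda>x. (norm (D\<eta> x))\<^sup>2 * v x powr (- (2 * p)))"
    by (rule Cc_on_integrable[OF Cc_on_mult[OF CcD cp]])
  have iZ: "integrable lborel (\<lambda>x. (\<eta> x)\<^sup>2 * (v x powr (- (2 * p + 2)) * (norm (gradient v x))\<^sup>2))"
    by (rule Cc_on_integrable[OF Cc_on_mult[OF CcE]]) (intro continuous_intros cp v2)
  have iW: "integrable lborel (\<lambda>x. \<eta> x * (v x powr (- (2 * p + 1)) * inner (D\<eta> x) (gradient v x)))"
    by (rule Cc_on_integrable[OF Cc_on_mult[OF test_function_Cc(1)[OF \<eta>]]]) (intro continuous_intros cp cD v2)
  have gp: "GDERIV (\<lambda>x. v x powr a) x :> (a * v x powr (a - 1)) *\<^sub>R gradient v x" if "x \<in> \<Omega>" for a x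
    by (intro GDERIV_powr v2 pos that)
  have cgp: "continuous_on \<Omega> (\<lambda>x. (a * v x powr (a - 1)) *\<^sub>R gradient v x)" for a
    by (intro continuous_intros cp v2)
  have \<zeta>: "test_function \<Omega> (\<lambda>x. \<eta> x * v x powr a)
     (\<lambda>x. \<eta> x *\<^sub>R (a * v x powr (a - 1)) *\<^sub>R gradient v x + v x powr a *\<^sub>R D\<eta> x)" for a
    by (rule test_function_mult[OF \<eta> o gp cgp])
  show "X = (2 * p + 1) * Z - 2 * W"
  proof -
    note gi = green_identity[OF test_function_mult[OF \<zeta>[of "- (2 * p + 1)"] o ge cD] o C2]
    have l: "\<eta> x * v x powr (- (2 * p + 1)) * \<eta> x * laplacian v x = (\<eta> x)\<^sup>2 * v x powr (- (2 * p + 2))" for x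
    proof (cases "x \<in> \<Omega>")
      case True
      show ?thesis unfolding pw[OF True] eq[OF True] by (simp add: power2_eq_square)
    qed (simp add: out)
    have r: "inner ((\<eta> x * v x powr (- (2 * p + 1))) *\<^sub>R D\<eta> x
        + \<eta> x *\<^sub>R (\<eta> x *\<^sub>R (- (2 * p + 1) * v x powr (- (2 * p + 1) - 1)) *\<^sub>R gradient v x
          + v x powr (- (2 * p + 1)) *\<^sub>R D\<eta> x)) (gradient v x)
      = 2 * (\<eta> x * (v x powr (- (2 * p + 1)) * inner (D\<eta> x) (gradient v x)))
        - (2 * p + 1) * ((\<eta> x)\<^sup>2 * (v x powr (- (2 * p + 2)) * (norm (gradient v x))\<^sup>2))" for x
    proof (cases "x \<in> \<Omega>")
      case True
      have "v x \<noteq> 0" using pos[OF True] by simp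
      then show ?thesis unfolding pw[OF True] power2_norm_eq_inner inner_add_left inner_scaleR_left
        by (simp add: field_simps power2_eq_square)
    qed (simp add: out)
    show ?thesis
      using gi unfolding l r X_def Z_def W_def using iZ iW by simp
  qed
  show "X \<le> p\<^sup>2 * Z - 2 * p * W + Y"
  proof -
    note s = stable_test_function[OF st o \<zeta>[of "- p"] v2(2) pos]
    have l: "(\<eta> x * v x powr (- p))\<^sup>2 / (v x)\<^sup>2 = (\<eta> x)\<^sup>2 * v x powr (- (2 * p + 2))" for x
    proof (cases "x \<in> \<Omega>")
      case True
      show ?thesis unfolding pw[OF True] by (simp add: power_mult_distrib)
    qed (simp add: out)
    have r: "(norm (\<eta> x *\<^sub>R (- p * v x powr (- p - 1)) *\<^sub>R gradient v x + v x powr (- p) *\<^sub>R D\<eta> x))\<^sup>2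
      = p\<^sup>2 * ((\<eta> x)\<^sup>2 * (v x powr (- (2 * p + 2)) * (norm (gradient v x))\<^sup>2))
        - 2 * p * (\<eta> x * (v x powr (- (2 * p + 1)) * inner (D\<eta> x) (gradient v x)))
        + (norm (D\<eta> x))\<^sup>2 * v x powr (- (2 * p))" for x
    proof (cases "x \<in> \<Omega>")
      case True
      have "v x \<noteq> 0" using pos[OF True] by simp
      then show ?thesis unfolding pw[OF True] power2_norm_eq_inner inner_add_left inner_scaleR_left
          inner_add_right inner_scaleR_right inner_commute[of "gradient v x" "D\<eta> x"]
        by (simp add: field_simps power2_eq_square)
    qed (simp add: out)
    show ?thesis
      using s unfolding l r X_def Y_def Z_def W_def using iZ iW iY by simp
  qed
  show "2 * \<bar>W\<bar> \<le> \<epsilon> * Z + Y / \<epsilon>" if "\<epsilon> > 0"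
  proof -
    define I where "I x = \<epsilon> * ((\<eta> x)\<^sup>2 * (v x powr (- (2 * p + 2)) * (norm (gradient v x))\<^sup>2))
        + (norm (D\<eta> x))\<^sup>2 * v x powr (- (2 * p)) / \<epsilon>" for x
    define J where "J x = 2 * (\<eta> x * (v x powr (- (2 * p + 1)) * inner (D\<eta> x) (gradient v x)))" for x
    have II: "integral\<^sup>L lborel I = \<epsilon> * Z + Y / \<epsilon>"
      unfolding I_def Z_def Y_def using iZ iY by simp
    have iI: "integrable lborel I" unfolding I_def using iZ iY by simp
    have JJ: "integral\<^sup>L lborel J = 2 * W" unfolding J_def W_def by simp
    have iJ: "integrable lborel J" unfolding J_def using iW by simp
    have "\<bar>J x\<bar> \<le> I x" for x
    proof (cases "x \<in> \<Omega>")
      case True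
      define A where "A = \<bar>\<eta> x\<bar> * v x powr (- p) / v x * norm (gradient v x)"
      define B where "B = norm (D\<eta> x) * v x powr (- p)"
      have "\<bar>J x\<bar> = 2 * (\<bar>\<eta> x\<bar> * ((v x powr (- p))\<^sup>2 / v x * \<bar>inner (D\<eta> x) (gradient v x)\<bar>))"
        using pos[OF True] unfolding J_def pw[OF True] by (simp add: abs_mult)
      also have "\<dots> \<le> 2 * (\<bar>\<eta> x\<bar> * ((v x powr (- p))\<^sup>2 / v x * (norm (D\<eta> x) * norm (gradient v x))))"
        using pos[OF True] by (intro mult_left_mono Cauchy_Schwarz_ineq2) auto
      also have "\<dots> = 2 * A * B" by (simp add: A_def B_def power2_eq_square)
      also have "\<dots> \<le> \<epsilon> * A\<^sup>2 + B\<^sup>2 / \<epsilon>"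
      proof -
        have "0 \<le> (\<epsilon> * A - B)\<^sup>2 / \<epsilon>" using that by simp
        also have "\<dots> = \<epsilon> * A\<^sup>2 + B\<^sup>2 / \<epsilon> - 2 * A * B"
          using that by (simp add: field_simps power2_eq_square)
        finally show ?thesis by simp
      qed
      also have "\<dots> = I x"
        unfolding A_def B_def I_def pw[OF True] by (simp add: power_mult_distrib power_divide)
      finally show ?thesis .
    qed (simp add: I_def J_def out)
    then have "\<bar>integral\<^sup>L lborel J\<bar> \<le> integral\<^sup>L lborel I"
      using iI iJ by (intro order_trans[OF integral_abs_bound] integral_mono) auto
    then show ?thesis by (simp add: II JJ)
  qed
  show "Z \<ge> 0" "Y \<ge> 0" "X \<ge> 0" unfolding X_def Y_def Z_def by (auto intro!: Bochner_Integration.integral_nonneg)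
qed

text \<open>Neglecting the terms with \<open>D\<eta>\<close>, the two relations read \<open>X = (2 * p + 1) * Z\<close> and
  \<open>X \<le> p\<^sup>2 * Z\<close>; they force \<open>X\<close> to be controlled by the neglected terms as long as
  \<open>p\<^sup>2 < 2 * p + 1\<close>, that is \<open>p < 1 + sqrt 2\<close>. The exponent \<open>2 * p + 2\<close> of \<open>1 / v\<close> thus ranges up to
  \<open>4 + 2 * sqrt 2\<close>, the number in the dimension bound. The constant depends on \<open>p\<close> alone, which
  makes the estimate uniform along a sequence of solutions.\<close>

lemma stable_solution_caccioppoli:
  fixes p :: real
  assumes p: "0 \<le> p" "p < 1 + sqrt 2"
  obtains C where "C \<ge> 0"
    "\<And>(\<Omega> :: (real^'n::finite) set) v \<eta> D\<eta>. stable_solution \<Omega> v \<Longrightarrow> test_function \<Omega> \<eta> D\<eta> \<Longrightarrow>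
       integral\<^sup>L lborel (\<lambda>x. (\<eta> x)\<^sup>2 * v x powr (- (2 * p + 2)))
         \<le> C * integral\<^sup>L lborel (\<lambda>x. (norm (D\<eta> x))\<^sup>2 * v x powr (- (2 * p)))"
proof -
  have gap: "p\<^sup>2 < 2 * p + 1"
  proof -
    have "\<bar>p - 1\<bar> < sqrt 2"
      using p real_sqrt_ge_one[of 2] by (auto simp: abs_if intro: le_less_trans[of _ 1])
    then have "(p - 1)\<^sup>2 < 2"
      using real_sqrt_less_iff[of "(p - 1)\<^sup>2" 2] by simp
    then show ?thesis by (simp add: power2_eq_square algebra_simps)
  qed
  \<comment> \<open>Small enough for \<open>p\<^sup>2 + p \<epsilon> < 2 p + 1 - \<epsilon>\<close>, so that the mixed terms use up only half
    of the gap \<open>2 p + 1 - p\<^sup>2\<close>.\<close>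
  define \<epsilon> where "\<epsilon> = (2 * p + 1 - p\<^sup>2) / (2 * (p + 1))"
  have e: "\<epsilon> > 0" using gap p by (simp add: \<epsilon>_def)
  have "\<epsilon> * (p + 1) = (2 * p + 1 - p\<^sup>2) / 2" using p by (simp add: \<epsilon>_def divide_simps)
  then have lt: "p\<^sup>2 + p * \<epsilon> < 2 * p + 1 - \<epsilon>" using gap by (simp add: algebra_simps)
  define a where "a = p\<^sup>2 + p * \<epsilon>"
  define b where "b = 2 * p + 1 - \<epsilon>"
  have ab: "0 \<le> a" "a < b" using lt e p by (auto simp: a_def b_def)
  define C where "C = (a / \<epsilon> + b * (1 + p / \<epsilon>)) / (b - a)"
  show ?thesis
  proof (rule that)
    show "C \<ge> 0" using ab e p by (simp add: C_def)
    fix \<Omega> :: "(real^'n) set" and v \<eta> D\<eta>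
    assume v: "stable_solution \<Omega> v" and \<eta>: "test_function \<Omega> \<eta> D\<eta>"
    let ?X = "integral\<^sup>L lborel (\<lambda>x. (\<eta> x)\<^sup>2 * v x powr (- (2 * p + 2)))"
    let ?Y = "integral\<^sup>L lborel (\<lambda>x. (norm (D\<eta> x))\<^sup>2 * v x powr (- (2 * p)))"
    let ?Z = "integral\<^sup>L lborel (\<lambda>x. (\<eta> x)\<^sup>2 * (v x powr (- (2 * p + 2)) * (norm (gradient v x))\<^sup>2))"
    let ?W = "integral\<^sup>L lborel (\<lambda>x. \<eta> x * (v x powr (- (2 * p + 1)) * inner (D\<eta> x) (gradient v x)))"
    note s = stable_solution_absorption[OF v \<eta> p(1)]
    have w: "2 * \<bar>?W\<bar> \<le> \<epsilon> * ?Z + ?Y / \<epsilon>" by (rule s(3)[OF e])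
    have 1: "b * ?Z \<le> ?X + ?Y / \<epsilon>" using s(1) w by (simp add: b_def algebra_simps)
    have "p * (- (2 * ?W)) \<le> p * (\<epsilon> * ?Z + ?Y / \<epsilon>)" using w p by (intro mult_left_mono) linarith+
    then have 2: "?X \<le> a * ?Z + (1 + p / \<epsilon>) * ?Y"
      using s(2) by (simp add: a_def algebra_simps)
    have "b * ?X \<le> a * (b * ?Z) + b * ((1 + p / \<epsilon>) * ?Y)"
      using mult_left_mono[OF 2, of b] ab by (simp add: algebra_simps)
    also have "\<dots> \<le> a * (?X + ?Y / \<epsilon>) + b * ((1 + p / \<epsilon>) * ?Y)"
      using mult_left_mono[OF 1 ab(1)] by simp
    finally have "(b - a) * ?X \<le> (a / \<epsilon> + b * (1 + p / \<epsilon>)) * ?Y"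
      by (simp add: algebra_simps)
    then show "?X \<le> C * ?Y"
      using ab by (simp add: C_def pos_le_divide_eq mult.commute)
  qed
qed

text \<open>Young's inequality for the right-hand side of the Caccioppoli estimate, with \<open>b\<close> the value of the
  cut-off. If \<open>b\<^sup>2 / v\<^sup>2\<close> is at least \<open>l\<close>, the factor \<open>b\<^sup>2 / (l * v\<^sup>2)\<close> may be inserted; otherwise \<open>v\<close> is
  bounded below by a multiple of \<open>b\<close>, and \<open>p \<le> 3\<close> makes \<open>b ^ 6\<close> outweigh the negative power of \<open>b\<close>.\<close>

lemma absorb_negative_power:
  fixes b v p l :: real
  assumes "0 \<le> b" "b \<le> 1" "v > 0" "0 \<le> p" "p \<le> 3" "l > 0"
  shows "b ^ 6 * v powr (- (2 * p)) \<le> b ^ 8 * v powr (- (2 * p + 2)) / l + l powr p"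
proof (cases "b = 0")
  case True
  then show ?thesis by simp
next
  case False
  then have b: "b > 0" using assms by simp
  show ?thesis
  proof (cases "l \<le> b\<^sup>2 / v\<^sup>2")
    case True
    have "- (2 * p + 2) = - (2 * p) - 2" by simp
    then have e: "v powr (- (2 * p + 2)) = v powr (- (2 * p)) / v\<^sup>2"
      using assms by (simp only: powr_diff) (simp add: powr_numeral)
    have "b ^ 6 * v powr (- (2 * p)) * l \<le> b ^ 6 * v powr (- (2 * p)) * (b\<^sup>2 / v\<^sup>2)"
      using True assms by (intro mult_left_mono) auto
    also have "\<dots> = b ^ 8 * v powr (- (2 * p + 2))"
      unfolding e by (simp add: power_add[of b 6 2, simplified])
    finally have "b ^ 6 * v powr (- (2 * p)) \<le> b ^ 8 * v powr (- (2 * p + 2)) / l"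
      using assms by (simp add: pos_le_divide_eq)
    then show ?thesis using powr_ge_zero[of l p] by linarith
  next
    case False
    then have "b\<^sup>2 / l \<le> v\<^sup>2" using assms by (simp add: field_simps)
    then have "(v\<^sup>2) powr (- p) \<le> (b\<^sup>2 / l) powr (- p)"
      using assms b by (intro powr_mono2') auto
    moreover have "(v\<^sup>2) powr (- p) = v powr (- (2 * p))"
    proof -
      show ?thesis using powr_powr[of v 2 "- p"] assms by simp
    qed
    moreover have "(b\<^sup>2 / l) powr (- p) = b powr (- (2 * p)) * l powr p"
    proof -
      have "(b\<^sup>2) powr (- p) = b powr (- (2 * p))"
        using powr_powr[of b 2 "- p"] b by simp
      then show ?thesis using assms by (simp add: powr_divide powr_minus_divide[of l])
    qed
    ultimately have "b ^ 6 * v powr (- (2 * p)) \<le> b ^ 6 * (b powr (- (2 * p)) * l powr p)"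
      using b by (intro mult_left_mono) auto
    also have "\<dots> = b powr (6 - 2 * p) * l powr p"
    proof -
      have "b ^ 6 = b powr 6" using b by (simp add: powr_numeral)
      then show ?thesis using b by (simp add: powr_diff powr_minus field_simps)
    qed
    also have "\<dots> \<le> 1 * l powr p"
      using b assms by (intro mult_right_mono powr_le1) auto
    finally show ?thesis using assms by (simp add: add_increasing)
  qed
qed

text \<open>The Caccioppoli estimate is applied to the fourth power of a bump; the singular integral on its
  right-hand side is absorbed into the left by \<open>absorb_negative_power\<close>.\<close>

lemma stable_solution_negative_power_bound:
  fixes q R :: real and x0 :: "real^'n::finite"
  assumes q: "2 \<le> q" "q < 4 + 2 * sqrt 2" and R: "R > 0"
  obtains C where "C \<ge> 0" "\<And>\<Omega> v. stable_solution \<Omega> v \<Longrightarrow> cball x0 R \<subseteq> \<Omega> \<Longrightarrow>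
       integral\<^sup>L lborel (\<lambda>x. bump x0 R x ^ 8 * v x powr (- q)) \<le> C"
proof -
  define p where "p = (q - 2) / 2"
  have p: "0 \<le> p" "p < 1 + sqrt 2" "2 * p + 2 = q" using q by (auto simp: p_def field_simps)
  have "sqrt 2 \<le> 2" by (rule real_le_lsqrt) auto
  with p have p3: "p \<le> 3" by linarith
  obtain C where C: "C \<ge> 0" "\<And>(\<Omega> :: (real^'n) set) v \<eta> D\<eta>. stable_solution \<Omega> v \<Longrightarrow> test_function \<Omega> \<eta> D\<eta> \<Longrightarrow>
       integral\<^sup>L lborel (\<lambda>x. (\<eta> x)\<^sup>2 * v x powr (- (2 * p + 2)))
         \<le> C * integral\<^sup>L lborel (\<lambda>x. (norm (D\<eta> x))\<^sup>2 * v x powr (- (2 * p)))"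
    using stable_solution_caccioppoli[OF p(1,2)] by blast
  define c where "c = 64 / R\<^sup>2"
  have c: "c > 0" using R by (simp add: c_def)
  \<comment> \<open>This choice gives \<open>C * c / l \<le> 1 / 2\<close>, so that half of the left-hand side is absorbed.\<close>
  define l where "l = 2 * c * (C + 1)"
  have l: "l > 0" using c C by (simp add: l_def)
  define B where "B = measure lborel (cball x0 R)"
  show ?thesis
  proof (rule that)
    show "2 * (C * (c * (l powr p * B))) \<ge> 0" using C c by (simp add: B_def)
    fix \<Omega> :: "(real^'n) set" and v
    assume v: "stable_solution \<Omega> v" and sub: "cball x0 R \<subseteq> \<Omega>"
    have o: "open \<Omega>" and C2: "Ck_on 2 \<Omega> v" and pos: "\<And>x. x \<in> \<Omega> \<Longrightarrow> v x > 0"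
      using v unfolding stable_solution_def by auto
    note v2 = Ck_on_2D[OF C2 o]
    have cp: "continuous_on \<Omega> (\<lambda>x. v x powr a)" for a
      using v2(2) pos by (intro continuous_intros) force+
    define D where "D y = (- (2 * real 4 / R\<^sup>2) * bump x0 R y ^ (4 - 1)) *\<^sub>R (y - x0)" for y
    have tf: "test_function \<Omega> (\<lambda>y. bump x0 R y ^ 4) D"
      unfolding D_def using test_function_bump[OF sub R, of 4] by simp
    have nD: "(norm (D y))\<^sup>2 \<le> c * bump x0 R y ^ 6" for y
    proof -
      have "norm (D y) \<le> (2 * real 4 / R) * bump x0 R y ^ (4 - 1)"
        unfolding D_def by (rule norm_gradient_bump_le[OF R]) simp
      then have "(norm (D y))\<^sup>2 \<le> ((2 * real 4 / R) * bump x0 R y ^ (4 - 1))\<^sup>2"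
        by (intro power_mono) auto
      then show ?thesis by (simp add: c_def power_mult_distrib power_divide)
    qed
    let ?X = "integral\<^sup>L lborel (\<lambda>x. bump x0 R x ^ 8 * v x powr (- (2 * p + 2)))"
    let ?Y = "integral\<^sup>L lborel (\<lambda>x. (norm (D x))\<^sup>2 * v x powr (- (2 * p)))"
    have Cc: "Cc_on \<Omega> (\<lambda>x. bump x0 R x ^ 8 * v x powr (- (2 * p + 2)))"
      by (rule Cc_on_mult[OF test_function_Cc(1)[OF test_function_bump[OF sub R]] cp]) simp
    have CcY: "Cc_on \<Omega> (\<lambda>x. (norm (D x))\<^sup>2 * v x powr (- (2 * p)))"
    proof (rule Cc_on_mult[OF _ cp])
      show "Cc_on \<Omega> (\<lambda>x. (norm (D x))\<^sup>2)"
        using test_function_Cc(2)[OF tf] Cc_on_inner[of \<Omega> D D]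
        by (auto simp: power2_norm_eq_inner Cc_on_def)
    qed
    have ind: "integrable lborel (\<lambda>x. indicator (cball x0 R) x :: real)"
      by (intro integrable_real_indicator emeasure_lborel_cball_finite) auto
    have "(norm (D x))\<^sup>2 * v x powr (- (2 * p))
        \<le> c * (bump x0 R x ^ 8 * v x powr (- (2 * p + 2)) / l + l powr p * indicator (cball x0 R) x)" for x
    proof (cases "x \<in> cball x0 R")
      case True
      then have "v x > 0" using sub pos by blast
      have "(norm (D x))\<^sup>2 * v x powr (- (2 * p)) \<le> c * bump x0 R x ^ 6 * v x powr (- (2 * p))"
        by (intro mult_right_mono nD) auto
      also have "\<dots> \<le> c * (bump x0 R x ^ 8 * v x powr (- (2 * p + 2)) / l + l powr p)"
        using absorb_negative_power[OF bump_nonneg bump_le_1 \<open>v x > 0\<close> p(1) p3 l] c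
        by (simp add: mult.assoc)
      finally show ?thesis using True by simp
    next
      case False
      then have "bump x0 R x = 0" by (intro bump_outside R)
      then show ?thesis using False by (simp add: D_def)
    qed
    then have "?Y \<le> integral\<^sup>L lborel (\<lambda>x. c * (bump x0 R x ^ 8 * v x powr (- (2 * p + 2)) / l + l powr p * indicator (cball x0 R) x))"
      using Cc_on_integrable[OF Cc] Cc_on_integrable[OF CcY] ind
      by (intro integral_mono) auto
    also have "\<dots> = c * (?X / l + l powr p * B)"
      using Cc_on_integrable[OF Cc] ind by (simp add: B_def)
    finally have Y: "?Y \<le> c * (?X / l + l powr p * B)" .
    have X0: "?X \<ge> 0" by (intro Bochner_Integration.integral_nonneg) (simp add: bump_nonneg)
    have "?X \<le> C * ?Y" using C(2)[OF v tf] by (simp flip: power_mult)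
    also have "\<dots> \<le> C * (c * (?X / l + l powr p * B))" using Y C(1) by (intro mult_left_mono)
    also have "\<dots> = C / (C + 1) * (?X / 2) + C * (c * (l powr p * B))"
    proof -
      have "C + 1 \<noteq> 0" using C(1) by linarith
      then have "c / l = 1 / (C + 1) / 2" using c by (simp add: l_def)
      then have "C * (c / l * ?X) = C / (C + 1) * (?X / 2)" by simp
      then show ?thesis by (simp add: distrib_left mult.assoc)
    qed
    also have "\<dots> \<le> 1 * (?X / 2) + C * (c * (l powr p * B))"
      using C(1) X0 by (intro add_right_mono mult_right_mono) auto
    finally show "integral\<^sup>L lborel (\<lambda>x. bump x0 R x ^ 8 * v x powr (- q)) \<le> 2 * (C * (c * (l powr p * B)))"
      using p(3) by simp
  qed
qed

section \<open>Growth from a point at which a solution is small\<close>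

lemma integral_lborel_dilation:
  fixes g :: "real^'n::finite \<Rightarrow> real"
  assumes "continuous_on UNIV g" "r > 0"
  shows "integral\<^sup>L lborel g = r ^ CARD('n) * integral\<^sup>L lborel (\<lambda>z. g (x + r *\<^sub>R z))"
proof -
  have m: "g \<in> borel_measurable borel" using assms(1) by (rule borel_measurable_continuous_onI)
  have "integral\<^sup>L lborel g = integral\<^sup>L (density (distr lborel borel (\<lambda>z. x + r *\<^sub>R z)) (\<lambda>_. ennreal (\<bar>r\<bar> ^ DIM(real^'n)))) g"
    using assms(2) by (subst lborel_affine[of r x]) auto
  also have "\<dots> = integral\<^sup>L (distr lborel borel (\<lambda>z. x + r *\<^sub>R z)) (\<lambda>y. r ^ CARD('n) * g y)"
    using assms(2) m by (subst integral_density) auto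
  also have "\<dots> = integral\<^sup>L lborel (\<lambda>z. r ^ CARD('n) * g (x + r *\<^sub>R z))"
    using m by (subst integral_distr) auto
  finally show ?thesis by simp
qed

lemma bump_dilation: "r > 0 \<Longrightarrow> bump x r (x + r *\<^sub>R z) = bump 0 1 z"
  by (simp add: bump_def power_mult_distrib)

lemma Cc_on_bump:
  assumes "cball x r \<subseteq> \<Omega>" "r > 0" "k > 0"
  shows "Cc_on \<Omega> (\<lambda>y. bump x r y ^ k)"
  using assms bump_outside[OF assms(2), of _ x]
  by (intro Cc_onI[of _ _ "cball x r"] continuous_intros continuous_on_bump) (auto simp: power_0_left)

lemma integral_bump_dilation:
  "r > 0 \<Longrightarrow> integral\<^sup>L lborel (\<lambda>y. bump (x :: real^'n::finite) r y ^ k) =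
     r ^ CARD('n) * integral\<^sup>L lborel (\<lambda>y :: real^'n. bump 0 1 y ^ k)"
  by (subst integral_lborel_dilation[of _ r x]) (auto simp: bump_dilation intro!: continuous_intros continuous_on_bump)

lemma integral_bump_pos: 
  assumes "k > 0"
  shows "0 < integral\<^sup>L lborel (\<lambda>y :: real^'n::finite. bump 0 1 y ^ k)"
proof -
  let ?B = "cball (0 :: real^'n) (1 / 2)"
  have i: "integrable lborel (\<lambda>y :: real^'n. indicator ?B y :: real)"
    by (intro integrable_real_indicator emeasure_lborel_cball_finite) auto
  have "0 < (3 / 4) ^ k * measure lborel ?B"
    by (simp add: content_cball_pos)
  also have "\<dots> = integral\<^sup>L lborel (\<lambda>y :: real^'n. (3 / 4) ^ k * indicator ?B y)"
    by simp
  also have "\<dots> \<le> integral\<^sup>L lborel (\<lambda>y :: real^'n. bump 0 1 y ^ k)"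
  proof (rule integral_mono)
    show "integrable lborel (\<lambda>y :: real^'n. (3 / 4) ^ k * indicator ?B y :: real)" using i by simp
    show "integrable lborel (\<lambda>y :: real^'n. bump 0 1 y ^ k)"
      using assms by (intro Cc_on_integrable[of UNIV] Cc_on_bump) auto
    show "(3 / 4) ^ k * indicator ?B y \<le> bump 0 1 y ^ k" for y :: "real^'n"
      using bump_ge[of 1 y 0] by (cases "y \<in> ?B") (auto intro!: power_mono bump_nonneg zero_le_power simp: bump_nonneg)
  qed
  finally show ?thesis .
qed

text \<open>By the equation the integrand is \<open>1 / v\<close> times a cut-off. Stability with the test function
  \<open>bump x t ^ 2\<close> bounds the integral of \<open>1 / v\<^sup>2\<close> near \<open>x\<close> by a multiple of \<open>t ^ (n - 2)\<close>, and
  \<open>2 * t / v \<le> 1 + t\<^sup>2 / v\<^sup>2\<close> turns this into a bound of order \<open>t ^ (n - 1)\<close> for the integral of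
  \<open>1 / v\<close>.\<close>

lemma stable_solution_reciprocal_bound:
  fixes v :: "real^'n::finite \<Rightarrow> real"
  assumes v: "stable_solution \<Omega> v" and sub: "cball x t \<subseteq> \<Omega>" and t: "t > 0"
  shows "t * integral\<^sup>L lborel (\<lambda>y. bump x t y ^ 4 * laplacian v y)
    \<le> 17 / 2 * t ^ CARD('n) * integral\<^sup>L lborel (\<lambda>z :: real^'n. bump 0 1 z ^ 2)"
proof -
  have o: "open \<Omega>" and C2: "Ck_on 2 \<Omega> v" and pos: "\<And>x. x \<in> \<Omega> \<Longrightarrow> v x > 0"
    and eq: "\<And>x. x \<in> \<Omega> \<Longrightarrow> laplacian v x = 1 / v x" and st: "stable_on \<Omega> v"
    using v unfolding stable_solution_def by auto
  note v2 = Ck_on_2D[OF C2 o]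
  define I where "I k = integral\<^sup>L lborel (\<lambda>y. bump x t y ^ k)" for k
  have i: "integrable lborel (\<lambda>y. bump x t y ^ k)" if "k > 0" for k
    using that by (intro Cc_on_integrable[OF Cc_on_bump[OF sub t]])
  define D where "D y = (- (2 * real 2 / t\<^sup>2) * bump x t y ^ (2 - 1)) *\<^sub>R (y - x)" for y
  have tf: "test_function \<Omega> (\<lambda>y. bump x t y ^ 2) D"
    unfolding D_def using test_function_bump[OF sub t, of 2] by simp
  have "integral\<^sup>L lborel (\<lambda>y. (bump x t y ^ 2)\<^sup>2 / (v y)\<^sup>2) \<le> integral\<^sup>L lborel (\<lambda>y. (norm (D y))\<^sup>2)"
    by (rule stable_test_function[OF st o tf v2(2) pos])
  also have "\<dots> \<le> integral\<^sup>L lborel (\<lambda>y. 16 / t\<^sup>2 * bump x t y ^ 2)"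
  proof (rule integral_mono)
    show "integrable lborel (\<lambda>y. (norm (D y))\<^sup>2)"
      using Cc_on_integrable[OF Cc_on_inner[OF test_function_Cc(2)[OF tf], of D]] test_function_Cc(2)[OF tf]
      by (simp add: power2_norm_eq_inner Cc_on_def)
    show "integrable lborel (\<lambda>y. 16 / t\<^sup>2 * bump x t y ^ 2)" using i[of 2] by simp
    fix y
    have "norm (D y) \<le> (2 * real 2 / t) * bump x t y ^ (2 - 1)"
      unfolding D_def by (rule norm_gradient_bump_le[OF t]) simp
    then have "(norm (D y))\<^sup>2 \<le> ((2 * real 2 / t) * bump x t y ^ (2 - 1))\<^sup>2"
      by (intro power_mono) auto
    then show "(norm (D y))\<^sup>2 \<le> 16 / t\<^sup>2 * bump x t y ^ 2"
      by (simp add: power_mult_distrib power_divide)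
  qed
  also have "\<dots> = 16 / t\<^sup>2 * I 2" by (simp add: I_def)
  finally have S: "integral\<^sup>L lborel (\<lambda>y. bump x t y ^ 4 * (1 / (v y)\<^sup>2)) \<le> 16 / t\<^sup>2 * I 2"
    by (simp flip: power_mult)
  have "continuous_on \<Omega> (\<lambda>y. 1 / (v y)\<^sup>2)"
    using v2(2) pos by (intro continuous_intros) force+
  then have iS: "integrable lborel (\<lambda>y. bump x t y ^ 4 * (1 / (v y)\<^sup>2))"
    by (intro Cc_on_integrable[OF Cc_on_mult[OF Cc_on_bump[OF sub t]]]) auto
  have iL: "integrable lborel (\<lambda>y. bump x t y ^ 4 * laplacian v y)"
    by (intro Cc_on_integrable[OF Cc_on_mult[OF Cc_on_bump[OF sub t] v2(6)]]) auto
  have "t * integral\<^sup>L lborel (\<lambda>y. bump x t y ^ 4 * laplacian v y)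
      = integral\<^sup>L lborel (\<lambda>y. t * (bump x t y ^ 4 * laplacian v y))" by simp
  also have "\<dots> \<le> integral\<^sup>L lborel (\<lambda>y. bump x t y ^ 2 / 2 + t\<^sup>2 / 2 * (bump x t y ^ 4 * (1 / (v y)\<^sup>2)))"
  proof (rule integral_mono)
    show "integrable lborel (\<lambda>y. t * (bump x t y ^ 4 * laplacian v y))" using iL by simp
    show "integrable lborel (\<lambda>y. bump x t y ^ 2 / 2 + t\<^sup>2 / 2 * (bump x t y ^ 4 * (1 / (v y)\<^sup>2)))"
      using iS i[of 2] by (intro Bochner_Integration.integrable_add integrable_mult_right integrable_divide) auto
    fix y
    show "t * (bump x t y ^ 4 * laplacian v y) \<le> bump x t y ^ 2 / 2 + t\<^sup>2 / 2 * (bump x t y ^ 4 * (1 / (v y)\<^sup>2))"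
    proof (cases "y \<in> cball x t")
      case True
      then have y: "y \<in> \<Omega>" using sub by blast
      let ?b = "bump x t y ^ 2"
      define s where "s = t / v y"
      have "0 \<le> (?b * (s - 1))\<^sup>2" by simp
      then have "2 * (?b\<^sup>2 * s) \<le> ?b\<^sup>2 + ?b\<^sup>2 * s\<^sup>2"
        unfolding power_mult_distrib by (simp add: power2_eq_square[of "s - 1"] power2_eq_square[of s] algebra_simps)
      then have 2: "2 * (t * (?b\<^sup>2 / v y)) \<le> ?b\<^sup>2 + t\<^sup>2 * (?b\<^sup>2 / (v y)\<^sup>2)"
        by (simp add: s_def power_divide mult.commute)
      have 4: "?b\<^sup>2 \<le> ?b"
        by (simp add: bump_nonneg bump_le_1 power_decreasing flip: power_mult)
      have "a \<le> d / 2 + c / 2" if "2 * a \<le> b + c" "b \<le> d" for a b c d :: real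
        using that by linarith
      from this[OF 2 4] have "t * (?b\<^sup>2 / v y) \<le> ?b / 2 + t\<^sup>2 / 2 * (?b\<^sup>2 * (1 / (v y)\<^sup>2))" by simp
      then show ?thesis using eq[OF y] by (simp flip: power_mult)
    next
      case False
      then have "bump x t y = 0" by (rule bump_outside[OF t])
      then show ?thesis by simp
    qed
  qed
  also have "\<dots> = I 2 / 2 + t\<^sup>2 / 2 * integral\<^sup>L lborel (\<lambda>y. bump x t y ^ 4 * (1 / (v y)\<^sup>2))"
    unfolding I_def using iS i[of 2]
    by (subst Bochner_Integration.integral_add) (auto simp del: times_divide_eq_right)
  also have "\<dots> \<le> I 2 / 2 + t\<^sup>2 / 2 * (16 / t\<^sup>2 * I 2)"
    using S by (intro add_left_mono mult_left_mono) auto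
  also have "\<dots> = 17 / 2 * I 2" using t by (simp add: field_simps)
  finally show ?thesis using integral_bump_dilation[OF t, of x 2] by (simp add: I_def)
qed

text \<open>A substitute for a gradient bound: although \<open>v\<close> is subharmonic, its weighted averages over balls
  exceed its value at the centre by at most a multiple of the radius. With \<open>\<phi> = bump 0 1 ^ 3\<close> let
  \<open>F t\<close> be the integral of \<open>v (x + t z) \<phi> z\<close> over \<open>z\<close>. In its derivative the vector field \<open>\<phi> z *\<^sub>R z\<close>
  is a multiple of the gradient of \<open>bump 0 1 ^ 4\<close>, and by Green's identity \<open>F' t\<close> is a scaled
  integral of \<open>1 / v\<close> over \<open>cball x t\<close>, which the preceding lemma bounds by a constant. Integration
  over \<open>{0..r}\<close> gives the claim.\<close>

lemma stable_solution_average_growth: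
  obtains B C :: real where "B > 0" "C > 0"
    "\<And>\<Omega> v (x :: real^'n::finite) r. stable_solution \<Omega> v \<Longrightarrow> r > 0 \<Longrightarrow> cball x (B * r) \<subseteq> \<Omega> \<Longrightarrow> 
       integral\<^sup>L lborel (\<lambda>y. bump x r y ^ 3 * v y)
         \<le> r ^ CARD('n) * (v x * integral\<^sup>L lborel (\<lambda>z :: real^'n. bump 0 1 z ^ 3) + C * r)"
proof -
  obtain c :: "real^'n" where c: "cball 0 1 \<subseteq> cbox (- c) c"
    using bounded_subset_cbox_symmetric bounded_cball by metis
  \<comment> \<open>Differentiation under the integral sign takes place on a box, so \<open>\<Omega>\<close> has to contain the
    scaled boxes around \<open>x\<close>, and not only the balls; this is what the factor \<open>B\<close> provides.\<close>
  obtain B where B: "B > 0" "\<And>z. z \<in> cbox (- c) c \<Longrightarrow> norm z \<le> B"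
    using bounded_cbox[of "- c" c] unfolding bounded_pos by blast
  define \<omega> where "\<omega> = integral\<^sup>L lborel (\<lambda>z :: real^'n. bump 0 1 z ^ 2)"
  have \<omega>: "\<omega> > 0" unfolding \<omega>_def by (rule integral_bump_pos) simp
  show ?thesis
  proof (rule that[of "max B 1" "17 / 16 * \<omega>"])
    show "max B 1 > 0" "17 / 16 * \<omega> > 0" using \<omega> by auto
    fix \<Omega> v and x :: "real^'n" and r :: real
    assume v: "stable_solution \<Omega> v" and r: "r > 0" and sub: "cball x (max B 1 * r) \<subseteq> \<Omega>"
    have o: "open \<Omega>" and C2: "Ck_on 2 \<Omega> v" 
      using v unfolding stable_solution_def by auto
    note v2 = Ck_on_2D[OF C2 o]
    have inO: "x + t *\<^sub>R z \<in> \<Omega>" if "t \<in> {0..r}" "z \<in> cbox (- c) c" for t z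
    proof -
      have "t * norm z \<le> r * max B 1"
        using that B(2)[OF that(2)] r by (intro mult_mono) auto
      then have "x + t *\<^sub>R z \<in> cball x (max B 1 * r)"
        using that by (simp add: dist_norm mult.commute)
      then show ?thesis using sub by blast
    qed
    have subt: "cball x t \<subseteq> \<Omega>" if "t \<in> {0..r}" for t
    proof -
      have "1 * r \<le> max B 1 * r" using r by (intro mult_right_mono) auto
      moreover have "t \<le> r" using that by simp
      ultimately have "t \<le> max B 1 * r" by linarith
      then show ?thesis using sub by (auto simp: subset_iff)
    qed
    have out: "bump 0 1 z = 0" if "z \<notin> cbox (- c) c" for z
      using that c by (intro bump_outside) auto
    have vol: "integral (cbox (- c) c) (\<lambda>z. g (x + t *\<^sub>R z)) = integral\<^sup>L lborel g / t ^ CARD('n)"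
      if g: "Cc_on \<Omega> g" and t: "t \<in> {0<..r}" and g0: "\<And>y. y \<notin> cball x t \<Longrightarrow> g y = 0" for g :: "real^'n \<Rightarrow> real" and t
    proof -
      have cg: "continuous_on UNIV g" by (rule Cc_on_continuous_UNIV[OF g o])
      have "integral (cbox (- c) c) (\<lambda>z. g (x + t *\<^sub>R z)) = integral\<^sup>L lborel (\<lambda>z. g (x + t *\<^sub>R z))"
      proof (rule integral_cbox_eq_lborel)
        show "continuous_on UNIV (\<lambda>z. g (x + t *\<^sub>R z))"
          by (intro continuous_on_compose2[OF cg] continuous_intros) auto
        fix z assume "z \<notin> cbox (- c) c"
        then have "z \<notin> cball 0 1" using c by blast
        then have "norm z > 1" by simp
        then have "x + t *\<^sub>R z \<notin> cball x t" using t by (simp add: dist_norm)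
        then show "g (x + t *\<^sub>R z) = 0" by (rule g0)
      qed
      then show ?thesis using integral_lborel_dilation[OF cg, of t x] t by simp
    qed
    define F where "F t = integral (cbox (- c) c) (\<lambda>z. v (x + t *\<^sub>R z) * bump 0 1 z ^ 3)" for t
    define F' where "F' t = integral (cbox (- c) c) (\<lambda>z. inner (gradient v (x + t *\<^sub>R z)) z * bump 0 1 z ^ 3)" for t
    have F: "(F has_field_derivative F' t) (at t within {0..r})" if t: "t \<in> {0..r}" for t
      unfolding F_def F'_def
    proof (rule leibniz_rule_field_derivative[where fx = "\<lambda>t z. inner (gradient v (x + t *\<^sub>R z)) z * bump 0 1 z ^ 3"])
      show "((\<lambda>t. v (x + t *\<^sub>R z) * bump 0 1 z ^ 3) has_field_derivative
          inner (gradient v (x + t *\<^sub>R z)) z * bump 0 1 z ^ 3) (at t within {0..r})"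
        if "t \<in> {0..r}" "z \<in> cbox (- c) c" for t z
      proof -
        have "((\<lambda>t. x + t *\<^sub>R z) has_derivative (\<lambda>h. h *\<^sub>R z)) (at t within {0..r})"
          by (auto intro!: derivative_eq_intros)
        then have "((\<lambda>t. v (x + t *\<^sub>R z)) has_derivative (\<lambda>h. inner (h *\<^sub>R z) (gradient v (x + t *\<^sub>R z)))) (at t within {0..r})"
          using v2(1)[OF inO[OF that]] unfolding gderiv_def by (rule has_derivative_compose)
        then have "((\<lambda>t. v (x + t *\<^sub>R z)) has_field_derivative inner (gradient v (x + t *\<^sub>R z)) z) (at t within {0..r})"
          by (simp add: has_field_derivative_def inner_commute mult.commute[of _ "inner _ _"])
        then show ?thesis by (rule DERIV_cmult_right)
      qed
      show "(\<lambda>z. v (x + t *\<^sub>R z) * bump 0 1 z ^ 3) integrable_on cbox (- c) c" if "t \<in> {0..r}" for t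
        using inO[OF that]
        by (intro integrable_continuous continuous_on_mult continuous_on_compose2[OF v2(2)] 
            continuous_on_power continuous_on_bump) (auto intro!: continuous_intros)
      show "continuous_on ({0..r} \<times> cbox (- c) c) (\<lambda>(t, z). inner (gradient v (x + t *\<^sub>R z)) z * bump 0 1 z ^ 3)"
        unfolding case_prod_unfold using inO
        by (intro continuous_on_mult continuous_on_inner continuous_on_compose2[OF v2(3)]
            continuous_on_power continuous_on_compose2[OF continuous_on_bump[of UNIV]]) (auto intro!: continuous_intros)
    qed (use t in auto)
    have F'le: "F' t \<le> 17 / 16 * \<omega>" if t: "t \<in> {0<..r}" for t
    proof -
      have t0: "t > 0" and st: "cball x t \<subseteq> \<Omega>" using t subt[of t] by auto
      define g where "g y = bump x t y ^ 3 * (inner (gradient v y) (y - x) / t)" for y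
      have Ccg: "Cc_on \<Omega> g"
        unfolding g_def divide_inverse
        by (intro Cc_on_mult[OF Cc_on_bump[OF st t0]]) (auto intro!: continuous_intros v2)
      have "F' t = integral (cbox (- c) c) (\<lambda>z. g (x + t *\<^sub>R z))"
        unfolding F'_def g_def using t0 by (simp add: bump_dilation mult.commute)
      also have "\<dots> = integral\<^sup>L lborel g / t ^ CARD('n)"
        by (rule vol[OF Ccg t]) (auto simp: g_def bump_outside[OF t0])
      finally have 1: "F' t = integral\<^sup>L lborel g / t ^ CARD('n)" .
      have tf: "test_function \<Omega> (\<lambda>y. bump x t y ^ 4) (\<lambda>y. (- (8 / t\<^sup>2) * bump x t y ^ 3) *\<^sub>R (y - x))"
        using test_function_bump[OF st t0, of 4] by simp
      have ge: "g y = - (t / 8) * inner ((- (8 / t\<^sup>2) * bump x t y ^ 3) *\<^sub>R (y - x)) (gradient v y)" for y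
        using t0 by (simp add: g_def inner_commute power2_eq_square)
      have "integral\<^sup>L lborel g = - (t / 8) * integral\<^sup>L lborel (\<lambda>y. inner ((- (8 / t\<^sup>2) * bump x t y ^ 3) *\<^sub>R (y - x)) (gradient v y))"
        unfolding ge by (rule integral_mult_right_zero)
      then have "integral\<^sup>L lborel g = (t / 8) * integral\<^sup>L lborel (\<lambda>y. bump x t y ^ 4 * laplacian v y)"
        unfolding green_identity[OF tf o C2] by (simp only: minus_mult_minus)
      also have "\<dots> \<le> 17 / 16 * t ^ CARD('n) * \<omega>"
        using stable_solution_reciprocal_bound[OF v st t0] by (simp add: \<omega>_def)
      finally show ?thesis using t0 by (simp add: 1 pos_divide_le_eq mult_ac)
    qed
    obtain t where t: "t \<in> {0<..<r}" "F r - F 0 = F' t * (r - 0)"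
      using mvt_simple[of 0 r F "\<lambda>t h. F' t * h"] F r
      by (auto simp: has_field_derivative_def)
    have "F r = F 0 + F' t * r" using t(2) by simp
    also have "\<dots> \<le> F 0 + 17 / 16 * \<omega> * r"
      using F'le[of t] t(1) r by (intro add_left_mono mult_right_mono) auto
    finally have le: "F r \<le> F 0 + 17 / 16 * \<omega> * r" .
    have F0: "F 0 = v x * integral\<^sup>L lborel (\<lambda>z :: real^'n. bump 0 1 z ^ 3)"
    proof -
      have "integral (cbox (- c) c) (\<lambda>z :: real^'n. bump 0 1 z ^ 3) = integral\<^sup>L lborel (\<lambda>z :: real^'n. bump 0 1 z ^ 3)"
        using out by (intro integral_cbox_eq_lborel continuous_on_power continuous_on_bump) auto
      then show ?thesis by (simp add: F_def)
    qed
    have sr: "cball x r \<subseteq> \<Omega>" using subt[of r] r by simp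
    have "F r = integral (cbox (- c) c) (\<lambda>z. bump x r (x + r *\<^sub>R z) ^ 3 * v (x + r *\<^sub>R z))"
      unfolding F_def using r by (simp add: bump_dilation mult.commute)
    also have "\<dots> = integral\<^sup>L lborel (\<lambda>y. bump x r y ^ 3 * v y) / r ^ CARD('n)"
      by (rule vol) (use r bump_outside[OF r, of _ x] in \<open>auto intro!: Cc_on_mult[OF Cc_on_bump[OF sr r] v2(2)]\<close>)
    finally show "integral\<^sup>L lborel (\<lambda>y. bump x r y ^ 3 * v y)
         \<le> r ^ CARD('n) * (v x * integral\<^sup>L lborel (\<lambda>z :: real^'n. bump 0 1 z ^ 3) + 17 / 16 * \<omega> * r)"
      using le r by (simp add: F0 pos_divide_le_eq mult.commute)
  qed
qed

text \<open>The graph of \<open>\<lambda>v. v powr (- q)\<close> lies above its tangent at \<open>t\<close>, by convexity.\<close>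

lemma powr_minus_tangent_le:
  fixes v t q :: real
  assumes "v > 0" "t > 0" "q \<ge> 0"
  shows "t powr (- q) * (1 + q - q / t * v) \<le> v powr (- q)"
proof -
  have "1 + q - q / t * v = 1 - q * (v / t - 1)" by (simp add: algebra_simps)
  also have "\<dots> \<le> 1 - q * ln (v / t)"
    using assms ln_le_minus_one[of "v / t"] by (intro diff_left_mono mult_left_mono) auto
  also have "\<dots> \<le> exp (- q * ln (v / t))"
    using exp_ge_add_one_self[of "- q * ln (v / t)"] by simp
  also have "\<dots> = (v / t) powr (- q)" using assms by (simp add: powr_def)
  also have "\<dots> = v powr (- q) / t powr (- q)" using assms by (simp add: powr_divide)
  finally show ?thesis using assms by (simp add: pos_le_divide_eq mult.commute)
qed

text \<open>Where \<open>v x \<le> r\<close>, the average of \<open>v\<close> over \<open>cball x r\<close> is at most of order \<open>r\<close>. Jensen's inequality, in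
  the form of the tangent inequality at a point \<open>t\<close> proportional to \<open>r\<close>, then makes the
  average of \<open>v powr (- q)\<close> at least of order \<open>r powr (- q)\<close>.\<close>

lemma stable_solution_concentration:
  fixes q :: real
  assumes q: "q > 0"
  obtains B c :: real where "B \<ge> 1" "c > 0"
    "\<And>\<Omega> v (x :: real^'n::finite) r. stable_solution \<Omega> v \<Longrightarrow> r > 0 \<Longrightarrow> cball x (B * r) \<subseteq> \<Omega> \<Longrightarrow> v x \<le> r \<Longrightarrow>
       c * r powr (real CARD('n) - q) \<le> integral\<^sup>L lborel (\<lambda>y. bump x r y ^ 3 * v y powr (- q))"
proof -
  obtain B C :: real where BC: "B > 0" "C > 0"
    "\<And>\<Omega> v (x :: real^'n::finite) r. stable_solution \<Omega> v \<Longrightarrow> r > 0 \<Longrightarrow> cball x (B * r) \<subseteq> \<Omega> \<Longrightarrow> 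
       integral\<^sup>L lborel (\<lambda>y. bump x r y ^ 3 * v y)
         \<le> r ^ CARD('n) * (v x * integral\<^sup>L lborel (\<lambda>z :: real^'n. bump 0 1 z ^ 3) + C * r)"
    using stable_solution_average_growth by blast
  define M where "M = integral\<^sup>L lborel (\<lambda>z :: real^'n. bump 0 1 z ^ 3)"
  have M: "M > 0" unfolding M_def by (rule integral_bump_pos) simp
  define K where "K = 1 + C / M"
  have K: "K > 0" using BC M by (simp add: K_def add_pos_pos)
  show ?thesis
  proof (rule that[of "max B 1" "M * K powr (- q)"])
    show "max B 1 \<ge> 1" "M * K powr (- q) > 0" using M K by auto
    fix \<Omega> v and x :: "real^'n" and r :: real
    assume v: "stable_solution \<Omega> v" and r: "r > 0" and sub: "cball x (max B 1 * r) \<subseteq> \<Omega>" and vx: "v x \<le> r"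
    have o: "open \<Omega>" and C2: "Ck_on 2 \<Omega> v" and pos: "\<And>x. x \<in> \<Omega> \<Longrightarrow> v x > 0"
      using v unfolding stable_solution_def by auto
    note v2 = Ck_on_2D[OF C2 o]
    have cp: "continuous_on \<Omega> (\<lambda>x. v x powr a)" for a
      using v2(2) pos by (intro continuous_intros) force+
    have "B * r \<le> max B 1 * r" "1 * r \<le> max B 1 * r"
      using r by (auto intro!: mult_right_mono simp del: mult_1)
    then have subB: "cball x (B * r) \<subseteq> \<Omega>" and sr: "cball x r \<subseteq> \<Omega>"
      using sub by (auto simp: subset_iff)
    define t where "t = K * r"
    have t: "t > 0" using K r by (simp add: t_def)
    have i0: "integrable lborel (\<lambda>y. bump x r y ^ 3)"
      by (intro Cc_on_integrable[OF Cc_on_bump[OF sr r]]) auto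
    have i1: "integrable lborel (\<lambda>y. bump x r y ^ 3 * v y)"
      by (intro Cc_on_integrable[OF Cc_on_mult[OF Cc_on_bump[OF sr r] v2(2)]]) auto
    have i2: "integrable lborel (\<lambda>y. bump x r y ^ 3 * v y powr (- q))"
      by (intro Cc_on_integrable[OF Cc_on_mult[OF Cc_on_bump[OF sr r] cp]]) auto
    have "v x * M + C * r \<le> r * M + C * r" using vx M by (intro add_right_mono mult_right_mono) auto
    also have "\<dots> = M * t" using M by (simp add: t_def K_def field_simps)
    finally have "r ^ CARD('n) * (v x * M + C * r) \<le> r ^ CARD('n) * (M * t)"
      using r by (intro mult_left_mono) auto
    with BC(3)[OF v r subB] have avg: "integral\<^sup>L lborel (\<lambda>y. bump x r y ^ 3 * v y) \<le> r ^ CARD('n) * (M * t)"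
      by (simp add: M_def)
    have b3: "integral\<^sup>L lborel (\<lambda>y. bump x r y ^ 3) = r ^ CARD('n) * M"
      unfolding M_def by (rule integral_bump_dilation[OF r])
    have "M * K powr (- q) * r powr (real CARD('n) - q) = t powr (- q) * (r ^ CARD('n) * M)"
      using r K by (simp add: t_def powr_mult powr_diff powr_minus powr_realpow field_simps)
    also have "\<dots> = t powr (- q) * ((1 + q) * (r ^ CARD('n) * M) - q / t * (r ^ CARD('n) * (M * t)))"
      using t by (simp add: algebra_simps)
    also have "\<dots> \<le> t powr (- q) * ((1 + q) * (r ^ CARD('n) * M) - q / t * integral\<^sup>L lborel (\<lambda>y. bump x r y ^ 3 * v y))"
      using avg t q by (intro mult_left_mono diff_left_mono) auto
    also have "\<dots> = integral\<^sup>L lborel (\<lambda>y. t powr (- q) * ((1 + q) * bump x r y ^ 3 - q / t * (bump x r y ^ 3 * v y)))"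
      using i0 i1 by (simp add: b3)
    also have "\<dots> \<le> integral\<^sup>L lborel (\<lambda>y. bump x r y ^ 3 * v y powr (- q))"
    proof (rule integral_mono[OF _ i2])
      show "integrable lborel (\<lambda>y. t powr (- q) * ((1 + q) * bump x r y ^ 3 - q / t * (bump x r y ^ 3 * v y)))"
        by (intro integrable_mult_right Bochner_Integration.integrable_diff i0 i1)
      fix y
      show "t powr (- q) * ((1 + q) * bump x r y ^ 3 - q / t * (bump x r y ^ 3 * v y)) \<le> bump x r y ^ 3 * v y powr (- q)"
      proof (cases "y \<in> cball x r")
        case True
        then have "v y > 0" using sr pos by blast
        then have "bump x r y ^ 3 * (t powr (- q) * (1 + q - q / t * v y)) \<le> bump x r y ^ 3 * v y powr (- q)"
          using powr_minus_tangent_le[of "v y" t q] t q by (intro mult_left_mono) (auto simp: bump_nonneg)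
        then show ?thesis by (simp add: algebra_simps)
      next
        case False
        then have "bump x r y = 0" by (rule bump_outside[OF r])
        then show ?thesis by simp
      qed
    qed
    finally show "M * K powr (- q) * r powr (real CARD('n) - q)
        \<le> integral\<^sup>L lborel (\<lambda>y. bump x r y ^ 3 * v y powr (- q))" .
  qed
qed

section \<open>Packing estimates and Hausdorff measure\<close>

text \<open>Around each of the separated points, for a late member of the sequence, the integral of
  \<open>us j powr (- q)\<close> over a ball of radius \<open>r\<close> is at least \<open>c * r powr (n - q)\<close>. The balls are disjoint and
  the integral over their union is bounded independently of \<open>j\<close>. The index \<open>j\<close> is chosen after
  \<open>P\<close> and \<open>r\<close>.\<close>

lemma zero_set_packing:
  fixes q :: real and x0 :: "real^'n::finite"
  assumes v: "\<And>j. stable_solution \<Omega> (us j)" and x0: "x0 \<in> \<Omega>"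
    and A: "\<And>x. x \<in> A \<Longrightarrow> (\<lambda>j. us j x) \<longlonglongrightarrow> 0"
    and q: "2 \<le> q" "q < 4 + 2 * sqrt 2"
  obtains \<rho> r0 C where "\<rho> > 0" "r0 > 0" "C \<ge> 0"
    "\<And>P r. finite P \<Longrightarrow> P \<subseteq> A \<inter> ball x0 \<rho> \<Longrightarrow> 0 < r \<Longrightarrow> r < r0 \<Longrightarrow> pairwise (\<lambda>x y. dist x y > 2 * r) P \<Longrightarrow>
       real (card P) * r powr (real CARD('n) - q) \<le> C"
proof -
  have o: "open \<Omega>" and C2: "\<And>j. Ck_on 2 \<Omega> (us j)" and pos: "\<And>j x. x \<in> \<Omega> \<Longrightarrow> us j x > 0"
    using v unfolding stable_solution_def by auto
  obtain R where R: "R > 0" "cball x0 R \<subseteq> \<Omega>" using o x0 open_contains_cball by blast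
  obtain C where C: "C \<ge> 0" "\<And>\<Omega> v. stable_solution \<Omega> v \<Longrightarrow> cball x0 R \<subseteq> \<Omega> \<Longrightarrow>
       integral\<^sup>L lborel (\<lambda>x. bump x0 R x ^ 8 * v x powr (- q)) \<le> C"
    using stable_solution_negative_power_bound[OF q R(1)] by blast
  have "q > 0" using q by simp
  then obtain B c :: real where B: "B \<ge> 1" and c: "c > 0"
    "\<And>\<Omega> v (x :: real^'n) r. stable_solution \<Omega> v \<Longrightarrow> r > 0 \<Longrightarrow> cball x (B * r) \<subseteq> \<Omega> \<Longrightarrow> v x \<le> r \<Longrightarrow>
       c * r powr (real CARD('n) - q) \<le> integral\<^sup>L lborel (\<lambda>y. bump x r y ^ 3 * v y powr (- q))"
    using stable_solution_concentration by blast
  show ?thesis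
  proof (rule that[of "R / 4" "R / (4 * B)" "10 * C / c"])
    show "R / 4 > 0" "R / (4 * B) > 0" "10 * C / c \<ge> 0" using R B C c by auto
    fix P and r :: real
    assume P: "finite P" "P \<subseteq> A \<inter> ball x0 (R / 4)" and r: "0 < r" "r < R / (4 * B)"
      and sep: "pairwise (\<lambda>x y. dist x y > 2 * r) P"
    have Br: "B * r < R / 4" using r B by (simp add: field_simps)
    moreover have "1 * r \<le> B * r" using B r by (intro mult_right_mono) auto
    ultimately have rR: "r < R / 4" by linarith
    have near: "cball x s \<subseteq> cball x0 (R / 2)" if "x \<in> P" "s < R / 4" for x s
    proof
      fix y assume "y \<in> cball x s"
      moreover have "dist x0 x < R / 4" using that P by auto
      ultimately show "y \<in> cball x0 (R / 2)"
        using that(2) dist_triangle[of x0 y x] by simp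
    qed
    have half: "cball x0 (R / 2) \<subseteq> \<Omega>" using R by (intro order_trans[OF _ R(2)]) auto
    have "eventually (\<lambda>j. \<forall>x\<in>P. us j x \<le> r) sequentially"
    proof (intro eventually_ball_finite P(1) ballI)
      fix x assume "x \<in> P"
      then have "(\<lambda>j. us j x) \<longlonglongrightarrow> 0" using A P by blast
      then have "eventually (\<lambda>j. us j x < r) sequentially" using r by (intro order_tendstoD(2))
      then show "eventually (\<lambda>j. us j x \<le> r) sequentially" by eventually_elim simp
    qed
    then obtain j where j: "\<And>x. x \<in> P \<Longrightarrow> us j x \<le> r"
      by (auto simp: eventually_sequentially)
    note v2 = Ck_on_2D[OF C2[of j] o]
    have cp: "continuous_on \<Omega> (\<lambda>x. us j x powr a)" for a
      using v2(2) pos[of _ j] by (intro continuous_intros) force+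
    have i: "integrable lborel (\<lambda>y. bump x r y ^ 3 * us j y powr (- q))" if "x \<in> P" for x
      using near[OF that rR] half r
      by (intro Cc_on_integrable[OF Cc_on_mult[OF Cc_on_bump cp]]) auto
    have i0: "integrable lborel (\<lambda>y. bump x0 R y ^ 8 * us j y powr (- q))"
      by (intro Cc_on_integrable[OF Cc_on_mult[OF Cc_on_bump[OF R(2,1)] cp]]) auto
    \<comment> \<open>The supports on the left are disjoint and lie in \<open>cball x0 (R / 2)\<close>, where the bump on the
      right is at least \<open>3 / 4\<close>; and \<open>10 * (3 / 4) ^ 8 > 1\<close>.\<close>
    have pt: "(\<Sum>x\<in>P. bump x r y ^ 3) \<le> 10 * bump x0 R y ^ 8" for y
    proof (cases "\<exists>x\<in>P. y \<in> cball x r")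
      case True
      then obtain x where x: "x \<in> P" "y \<in> cball x r" by blast
      have "bump x' r y = 0" if "x' \<in> P - {x}" for x'
      proof (rule bump_outside[OF r(1)])
        have "dist x x' > 2 * r" using sep x that unfolding pairwise_def by auto
        then show "y \<notin> cball x' r" using x dist_triangle[of x x' y] by (auto simp: dist_commute)
      qed
      then have "(\<Sum>x\<in>P. bump x r y ^ 3) = bump x r y ^ 3"
        using P(1) x(1) by (simp add: sum.remove)
      also have "\<dots> \<le> 1" by (simp add: bump_nonneg bump_le_1 power_le_one)
      also have "\<dots> \<le> 10 * (3 / 4) ^ 8" by (simp add: power_divide)
      also have "\<dots> \<le> 10 * bump x0 R y ^ 8"
        using near[OF x(1) rR] x(2) bump_ge[OF R(1), of y x0] by (intro mult_left_mono power_mono) auto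
      finally show ?thesis .
    next
      case False
      then have "(\<Sum>x\<in>P. bump x r y ^ 3) = 0" using bump_outside[OF r(1), of y] by (intro sum.neutral) auto
      then show ?thesis using bump_nonneg[of x0 R y] by simp
    qed
    have "real (card P) * (c * r powr (real CARD('n) - q)) = (\<Sum>x\<in>P. c * r powr (real CARD('n) - q))"
      by simp
    also have "\<dots> \<le> (\<Sum>x\<in>P. integral\<^sup>L lborel (\<lambda>y. bump x r y ^ 3 * us j y powr (- q)))"
      using near[OF _ Br] half by (intro sum_mono c(2)[OF v r(1)] j) auto
    also have "\<dots> = integral\<^sup>L lborel (\<lambda>y. \<Sum>x\<in>P. bump x r y ^ 3 * us j y powr (- q))"
      using i by (intro Bochner_Integration.integral_sum[symmetric])
    also have "\<dots> \<le> integral\<^sup>L lborel (\<lambda>y. 10 * (bump x0 R y ^ 8 * us j y powr (- q)))"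
    proof (rule integral_mono)
      show "integrable lborel (\<lambda>y. \<Sum>x\<in>P. bump x r y ^ 3 * us j y powr (- q))"
        using i by (intro Bochner_Integration.integrable_sum)
      show "integrable lborel (\<lambda>y. 10 * (bump x0 R y ^ 8 * us j y powr (- q)))" using i0 by simp
      show "(\<Sum>x\<in>P. bump x r y ^ 3 * us j y powr (- q)) \<le> 10 * (bump x0 R y ^ 8 * us j y powr (- q))" for y
        using mult_right_mono[OF pt[of y], of "us j y powr (- q)"] by (simp add: sum_distrib_right mult.assoc)
    qed
    also have "\<dots> \<le> 10 * C" using C(2)[OF v R(2), of j] by simp
    finally show "real (card P) * r powr (real CARD('n) - q) \<le> 10 * C / c"
      using c(1) by (simp add: pos_le_divide_eq mult_ac)
  qed
qed

lemma maximal_separated_cover: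
  fixes S :: "'a::metric_space set" and N :: nat
  assumes \<epsilon>: "\<epsilon> \<ge> 0"
    and bd: "\<And>P. finite P \<Longrightarrow> P \<subseteq> S \<Longrightarrow> pairwise (\<lambda>x y. dist x y > \<epsilon>) P \<Longrightarrow> card P \<le> N"
  obtains P where "finite P" "P \<subseteq> S" "pairwise (\<lambda>x y. dist x y > \<epsilon>) P" "S \<subseteq> (\<Union>p\<in>P. cball p \<epsilon>)"
proof -
  define ok where "ok P \<longleftrightarrow> finite P \<and> P \<subseteq> S \<and> pairwise (\<lambda>x y. dist x y > \<epsilon>) P" for P
  have "ok {}" by (simp add: ok_def)
  moreover have "\<forall>P. ok P \<longrightarrow> card P < Suc N" using bd by (auto simp: ok_def less_Suc_eq_le)
  ultimately obtain P where P: "ok P" "\<And>Q. ok Q \<Longrightarrow> card Q \<le> card P"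
    using ex_has_greatest_nat[of ok "{}" card "Suc N"] by auto
  have "S \<subseteq> (\<Union>p\<in>P. cball p \<epsilon>)"
  proof
    fix y assume y: "y \<in> S"
    show "y \<in> (\<Union>p\<in>P. cball p \<epsilon>)"
    proof (rule ccontr)
      assume far: "y \<notin> (\<Union>p\<in>P. cball p \<epsilon>)"
      have "y \<notin> P" using far \<epsilon> by force
      have "ok (insert y P)"
        using P y far unfolding ok_def by (auto simp: pairwise_insert dist_commute not_le)
      from P(2)[OF this] \<open>y \<notin> P\<close> P(1) show False by (simp add: ok_def)
    qed
  qed
  with P that show ?thesis unfolding ok_def by blast
qed

text \<open>A maximal \<open>2 * r\<close>-separated set \<open>P\<close> provides a cover by balls of diameter \<open>4 * r\<close>, with
  \<open>card P * (4 * r) powr s \<le> C * 4 powr s * r powr (s - d)\<close>, which tends to \<open>0\<close> with \<open>r\<close>.\<close>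

lemma hausdorff_measure_0_if_packing:
  fixes S :: "'a::euclidean_space set"
  assumes pack: "\<And>P r. finite P \<Longrightarrow> P \<subseteq> S \<Longrightarrow> 0 < r \<Longrightarrow> r < r0 \<Longrightarrow> pairwise (\<lambda>x y. dist x y > 2 * r) P \<Longrightarrow>
       real (card P) * r powr d \<le> C"
    and r0: "r0 > 0" and C: "C \<ge> 0" and s: "s > 0" "d < s"
  shows "hausdorff_measure s S = 0"
proof -
  have "hausdorff_premeasure s \<delta> S = 0" if \<delta>: "\<delta> > 0" for \<delta>
  proof -
    have le: "hausdorff_premeasure s \<delta> S \<le> ennreal (C * 4 powr s * r powr (s - d))"
      if r: "0 < r" "r < min r0 (\<delta> / 4)" for r
    proof -
      have "card P \<le> nat \<lfloor>C / r powr d\<rfloor>"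
        if "finite P" "P \<subseteq> S" "pairwise (\<lambda>x y. dist x y > 2 * r) P" for P
        using pack[OF that(1,2) _ _ that(3)] r by (simp add: le_nat_floor pos_le_divide_eq)
      then obtain P where P: "finite P" "P \<subseteq> S" "pairwise (\<lambda>x y. dist x y > 2 * r) P" "S \<subseteq> (\<Union>p\<in>P. cball p (2 * r))"
        using maximal_separated_cover[of "2 * r" S] r by (metis less_eq_real_def mult_nonneg_nonneg zero_le_numeral)
      obtain f where f: "bij_betw f {0..<card P} P" using ex_bij_betw_nat_finite[OF P(1)] by blast
      define U where "U i = (if i < card P then cball (f i) (2 * r) else {})" for i
      have "S \<subseteq> (\<Union>i. U i)"
      proof
        fix y assume "y \<in> S"
        then obtain p where p: "p \<in> P" "y \<in> cball p (2 * r)" using P(4) by blast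
        then obtain i where "i < card P" "p = f i"
          using f unfolding bij_betw_def by (metis atLeastLessThan_iff imageE)
        then have "y \<in> U i" using p by (simp add: U_def)
        then show "y \<in> (\<Union>i. U i)" by blast
      qed
      moreover have "bounded (U i) \<and> diameter (U i) \<le> \<delta>" for i
        using r \<delta> by (auto simp: U_def)
      ultimately have "hausdorff_premeasure s \<delta> S \<le> (\<Sum>i. diam_pow s (U i))"
        unfolding hausdorff_premeasure_def by (intro INF_lower) auto
      also have "\<dots> = (\<Sum>i<card P. diam_pow s (U i))"
        by (rule suminf_finite) (auto simp: U_def diam_pow_def)
      also have "\<dots> = (\<Sum>i<card P. ennreal ((4 * r) powr s))"
        using r s by (intro sum.cong) (auto simp: U_def diam_pow_def)
      also have "\<dots> = ennreal (real (card P) * (4 * r) powr s)"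
        by (simp add: ennreal_mult ennreal_of_nat_eq_real_of_nat)
      also have "\<dots> \<le> ennreal (C * 4 powr s * r powr (s - d))"
      proof (rule ennreal_leI)
        have "real (card P) * (4 * r) powr s = (real (card P) * r powr d) * (4 powr s * r powr (s - d))"
          using r by (simp add: powr_mult powr_diff)
        also have "\<dots> \<le> C * (4 powr s * r powr (s - d))"
          using pack[OF P(1,2) _ _ P(3)] r by (intro mult_right_mono) auto
        finally show "real (card P) * (4 * r) powr s \<le> C * 4 powr s * r powr (s - d)" by simp
      qed
      finally show ?thesis .
    qed
    have "((\<lambda>r. ennreal (C * 4 powr s * r powr (s - d))) \<longlongrightarrow> ennreal (C * 4 powr s * 0)) (at_right 0)"
      using s by (intro tendsto_ennrealI tendsto_mult tendsto_const tendsto_zero_powrI[where b = "s - d"])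
        (auto simp: eventually_at_filter)
    moreover have "eventually (\<lambda>r. hausdorff_premeasure s \<delta> S \<le> ennreal (C * 4 powr s * r powr (s - d))) (at_right 0)"
      using le r0 \<delta> unfolding eventually_at_right_field by (intro exI[of _ "min r0 (\<delta> / 4)"]) auto
    ultimately have "hausdorff_premeasure s \<delta> S \<le> ennreal (C * 4 powr s * 0)"
      by (rule tendsto_lowerbound) simp
    then show ?thesis by simp
  qed
  then show ?thesis unfolding hausdorff_measure_def by (simp add: SUP_eq_const)
qed

text \<open>The usual argument for outer measures: a cover of the \<open>k\<close>-th set with total weight below
  \<open>e / 2 ^ (k + 1)\<close> for each \<open>k\<close>, arranged in one sequence.\<close>

lemma hausdorff_measure_countable_Union_0:
  fixes A :: "nat \<Rightarrow> 'a::metric_space set"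
  assumes "\<And>k. hausdorff_measure s (A k) = 0"
  shows "hausdorff_measure s (\<Union>k. A k) = 0"
proof -
  have "hausdorff_premeasure s \<delta> (\<Union>k. A k) \<le> 0" if \<delta>: "\<delta> > 0" for \<delta>
  proof (rule ennreal_le_epsilon)
    fix e :: real assume e: "e > 0"
    have ex: "\<exists>U. A k \<subseteq> (\<Union>i. U i) \<and> (\<forall>i. bounded (U i) \<and> diameter (U i) \<le> \<delta>) \<and>
        (\<Sum>i. diam_pow s (U i)) < ennreal (e * (1 / 2) ^ Suc k)" for k
    proof -
      have "hausdorff_premeasure s \<delta> (A k) \<le> hausdorff_measure s (A k)"
        unfolding hausdorff_measure_def using \<delta> by (intro SUP_upper) auto
      then have "hausdorff_premeasure s \<delta> (A k) < ennreal (e * (1 / 2) ^ Suc k)"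
        using e assms[of k] by simp
      then show ?thesis unfolding hausdorff_premeasure_def INF_less_iff by auto
    qed
    then obtain U where U: "\<And>k. A k \<subseteq> (\<Union>i. U k i)" "\<And>k i. bounded (U k i) \<and> diameter (U k i) \<le> \<delta>"
        "\<And>k. (\<Sum>i. diam_pow s (U k i)) < ennreal (e * (1 / 2) ^ Suc k)"
      by metis
    define V where "V i = case_prod U (prod_decode i)" for i
    have "(\<Union>k. A k) \<subseteq> (\<Union>i. V i)"
    proof
      fix y assume "y \<in> (\<Union>k. A k)"
      then obtain k i where "y \<in> U k i" using U(1) by blast
      then have "y \<in> V (prod_encode (k, i))" by (simp add: V_def)
      then show "y \<in> (\<Union>i. V i)" by blast
    qed
    moreover have "bounded (V i) \<and> diameter (V i) \<le> \<delta>" for i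
      using U(2) by (simp add: V_def case_prod_unfold)
    ultimately have "hausdorff_premeasure s \<delta> (\<Union>k. A k) \<le> (\<Sum>i. diam_pow s (V i))"
      unfolding hausdorff_premeasure_def by (intro INF_lower) auto
    also have "\<dots> = (\<Sum>i. (\<lambda>(k, i). diam_pow s (U k i)) (prod_decode i))"
      by (simp add: V_def case_prod_unfold)
    also have "\<dots> = (\<Sum>k. \<Sum>i. diam_pow s (U k i))"
      by (rule suminf_ennreal_2dimen) simp
    also have "\<dots> \<le> (\<Sum>k. ennreal (e * (1 / 2) ^ Suc k))"
      using U(3) by (intro suminf_le less_imp_le) auto
    also have "\<dots> = ennreal e"
    proof -
      have "(\<lambda>k. e * (1 / 2) ^ Suc k) sums (e * 1)"
        by (intro sums_mult power_half_series)
      then show ?thesis using e by (intro suminf_ennreal_eq) auto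
    qed
    finally show "hausdorff_premeasure s \<delta> (\<Union>k. A k) \<le> 0 + ennreal e" by simp
  qed
  then show ?thesis unfolding hausdorff_measure_def by (simp add: SUP_eq_const)
qed

section \<open>The dimension bound\<close>

lemma stable_solution_if_positive_stable:
  "open \<Omega> \<Longrightarrow> positive_solution \<Omega> v \<Longrightarrow> stable_on \<Omega> v \<Longrightarrow> stable_solution \<Omega> v"
  unfolding positive_solution_def smooth_on_def stable_solution_def by blast

text \<open>The packing estimate is local; by the Lindelof property countably many of the balls on which it
  holds cover \<open>\<Omega>\<close>.\<close>

lemma zero_set_hausdorff_measure_0:
  fixes \<Omega> :: "(real^'n::finite) set"
  assumes v: "\<And>j. stable_solution \<Omega> (us j)" and A: "\<And>x. x \<in> A \<Longrightarrow> (\<lambda>j. us j x) \<longlonglongrightarrow> 0" "A \<subseteq> \<Omega>"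
    and q: "2 \<le> q" "q < 4 + 2 * sqrt 2" and s: "s > 0" "real CARD('n) - q < s"
  shows "hausdorff_measure s A = 0"
proof (cases "\<Omega> = {}")
  case True
  have "hausdorff_measure s ({} :: (real^'n) set) = 0"
    by (rule hausdorff_measure_0_if_packing[of _ 1 0 0 s]) (use s in auto)
  then show ?thesis using True A by simp
next
  case False
  have "\<exists>\<rho>>0. hausdorff_measure s (A \<inter> ball x0 \<rho>) = 0" if x0: "x0 \<in> \<Omega>" for x0
  proof -
    obtain \<rho> r0 C where *: "\<rho> > 0" "r0 > 0" "C \<ge> 0"
      "\<And>P r. finite P \<Longrightarrow> P \<subseteq> A \<inter> ball x0 \<rho> \<Longrightarrow> 0 < r \<Longrightarrow> r < r0 \<Longrightarrow> pairwise (\<lambda>x y. dist x y > 2 * r) P \<Longrightarrow>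
         real (card P) * r powr (real CARD('n) - q) \<le> C"
      using zero_set_packing[OF v x0 A(1) q] by blast
    have "hausdorff_measure s (A \<inter> ball x0 \<rho>) = 0"
      by (rule hausdorff_measure_0_if_packing[OF *(4) *(2,3) s])
    with *(1) show ?thesis by blast
  qed
  then obtain \<rho> where \<rho>: "\<And>x. x \<in> \<Omega> \<Longrightarrow> \<rho> x > 0" "\<And>x. x \<in> \<Omega> \<Longrightarrow> hausdorff_measure s (A \<inter> ball x (\<rho> x)) = 0"
    by metis
  obtain F where F: "F \<subseteq> (\<lambda>x. ball x (\<rho> x)) ` \<Omega>" "countable F" "\<Union>F = (\<Union>x\<in>\<Omega>. ball x (\<rho> x))"
    using Lindelof[of "(\<lambda>x. ball x (\<rho> x)) ` \<Omega>"] by auto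
  have cov: "\<Omega> \<subseteq> \<Union>F" using \<rho>(1) by (auto simp: F(3))
  then have ne: "F \<noteq> {}" using False by blast
  have "hausdorff_measure s (\<Union>k. A \<inter> from_nat_into F k) = 0"
  proof (rule hausdorff_measure_countable_Union_0)
    show "hausdorff_measure s (A \<inter> from_nat_into F k) = 0" for k
      using from_nat_into[OF ne, of k] F(1) \<rho>(2) by auto
  qed
  moreover have "(\<Union>k. A \<inter> from_nat_into F k) = A"
  proof -
    have "(\<Union>k. A \<inter> from_nat_into F k) = A \<inter> (\<Union>k. from_nat_into F k)" by (rule Int_UN_distrib[symmetric])
    also have "\<dots> = A \<inter> \<Union>F" using ne F(2) by (simp add: range_from_nat_into)
    also have "\<dots> = A" using cov A(2) by (intro Int_absorb2) (rule order_trans)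
    finally show ?thesis .
  qed
  ultimately show ?thesis by simp
qed

text \<open>A single zero is already a packing, with \<open>card P = 1\<close> for every \<open>r\<close>. If \<open>q\<close> exceeded the
  dimension, \<open>r powr (n - q)\<close> would be unbounded as \<open>r\<close> tends to \<open>0\<close>. In low dimensions this shows
  that the limit has no zeros at all.\<close>

lemma zero_set_dimension_ge:
  fixes \<Omega> :: "(real^'n::finite) set"
  assumes v: "\<And>j. stable_solution \<Omega> (us j)" and x0: "x0 \<in> \<Omega>" "(\<lambda>j. us j x0) \<longlonglongrightarrow> 0"
    and q: "2 \<le> q" "q < 4 + 2 * sqrt 2"
  shows "q \<le> real CARD('n)"
proof (rule ccontr)
  assume "\<not> ?thesis"
  then have neg: "real CARD('n) - q < 0" by simp
  have lim: "(\<lambda>j. us j x) \<longlonglongrightarrow> 0" if "x \<in> {x0}" for x using that x0(2) by simp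
  obtain \<rho> r0 C where *: "\<rho> > 0" "r0 > 0" "C \<ge> 0"
    "\<And>P r. finite P \<Longrightarrow> P \<subseteq> {x0} \<inter> ball x0 \<rho> \<Longrightarrow> 0 < r \<Longrightarrow> r < r0 \<Longrightarrow> pairwise (\<lambda>x y. dist x y > 2 * r) P \<Longrightarrow>
       real (card P) * r powr (real CARD('n) - q) \<le> C"
    using zero_set_packing[where us = us, OF v x0(1) lim q] by blast
  define r where "r = min (r0 / 2) ((C + 1) powr (1 / (real CARD('n) - q)))"
  have r: "0 < r" "r < r0" using * by (auto simp: r_def)
  have "C + 1 = ((C + 1) powr (1 / (real CARD('n) - q))) powr (real CARD('n) - q)"
    using neg *(3) by (simp add: powr_powr)
  also have "\<dots> \<le> r powr (real CARD('n) - q)"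
    using neg r by (intro powr_mono2') (auto simp: r_def)
  also have "\<dots> \<le> C" using *(4)[of "{x0}" r] r *(1) by simp
  finally show False by simp
qed

theorem theorem5:
  fixes \<Omega> :: "(real^'n::finite) set"
    and u :: "real^'n \<Rightarrow> real"
    and us :: "nat \<Rightarrow> real^'n \<Rightarrow> real"
  assumes "open \<Omega>" and "connected \<Omega>" and "\<Omega> \<noteq> {}"
    and "\<And>j. positive_solution \<Omega> (us j)"
    and "\<And>j. stable_on \<Omega> (us j)"
    and "\<And>x. x \<in> \<Omega> \<Longrightarrow> u x \<ge> 0"
    and "uniform_limit \<Omega> us u sequentially"
  shows "hausdorff_dim {x\<in>\<Omega>. u x = 0} \<le> ereal (real CARD('n) - 4 - 2 * sqrt 2)"
proof (cases "{x\<in>\<Omega>. u x = 0} = {}")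
  case True
  then show ?thesis unfolding hausdorff_dim_def by simp
next
  case False
  define A where "A = {x\<in>\<Omega>. u x = 0}"
  define \<kappa> where "\<kappa> = 4 + 2 * sqrt 2"
  have k: "\<kappa> > 2" by (simp add: \<kappa>_def add_pos_nonneg)
  have v: "stable_solution \<Omega> (us j)" for j
    using assms by (intro stable_solution_if_positive_stable)
  have A: "(\<lambda>j. us j x) \<longlonglongrightarrow> 0" if "x \<in> A" for x
    using tendsto_uniform_limitI[OF assms(7), of x] that by (simp add: A_def)
  obtain x0 where x0: "x0 \<in> A" using False A_def by blast
  have "\<kappa> \<le> real CARD('n)"
  proof (rule dense_le)
    fix q assume "q < \<kappa>"
    then have "max 2 q \<le> real CARD('n)"
      using zero_set_dimension_ge[OF v _ A[OF x0], of "max 2 q"] x0 k by (simp add: A_def \<kappa>_def)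
    then show "q \<le> real CARD('n)" by simp
  qed
  have "hausdorff_dim A \<le> ereal s" if s: "real CARD('n) - \<kappa> < s" for s
  proof -
    \<comment> \<open>Any exponent in \<open>[2, \<kappa>)\<close> above \<open>n - s\<close> serves; this one is at or above the midpoint of
      \<open>n - s\<close> and \<open>\<kappa>\<close>.\<close>
    define q where "q = max 2 ((real CARD('n) - s + \<kappa>) / 2)"
    have "s > 0" using s \<open>\<kappa> \<le> real CARD('n)\<close> by linarith
    moreover have "2 \<le> q" "q < \<kappa>" "real CARD('n) - q < s" using s k by (auto simp: q_def max_def field_simps)
    ultimately have "hausdorff_measure s A = 0"
      using v A by (intro zero_set_hausdorff_measure_0[of \<Omega> us A q s]) (auto simp: A_def \<kappa>_def)
    then show ?thesis
      using x0 \<open>s > 0\<close> unfolding hausdorff_dim_def by (auto intro!: Inf_lower)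
  qed
  then have "hausdorff_dim A \<le> ereal (real CARD('n) - \<kappa>)"
    using ereal_dense2[of "ereal (real CARD('n) - \<kappa>)" "hausdorff_dim A"] by (metis less_ereal.simps(1) not_le)
  then show ?thesis by (simp add: A_def \<kappa>_def algebra_simps)
qed

end
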